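(* Let $G$ be a finitely generated group acting $3$-discontinuously and $2$-cocompactly on a compactum $T$ with $|T|>2$. Let $f_0(n)=\lambda^n$ ($\lambda\in\,]0,1[$) be the exponential function associated with this action as in the context. Let $f$ be a Floyd function with $f\ge f_0$, and let $F:\partial_f G\to T$ be the Floyd map. Then for every parabolic point $p\in T$, $$F^{-1}(p)=\partial(\mathrm{Stab}_G\,p),$$ where $\partial(\mathrm{Stab}_G\,p)$ is the topological boundary of the subset $\mathrm{Stab}_G\,p\subset G$ in the Floyd completion $\overline G_f$. Furthermore, if $a,b\in\partial_fG$ and $p\in T$ satisfy $F(a)=F(b)=p$, then either $a=b$ or $p$ is parabolic.
   Context: A compactum is a compact Hausdorff space. $\Theta^nT$ is the space of $n$-element subsets of $T$ with the topology coming from $T^n$. An action of a discrete group $G$ on $T$ by homeomorphisms is $3$-discontinuous if the induced action on $\Theta^3T$ is properly discontinuous ($\{g: gK\cap L\ne\emptyset\}$ is finite for all compact $K,L\subset\Theta^3T$). It is $2$-cocompact if $\Theta^2T/G$ is compact. The limit set $\Lambda(G)$ is the complement in $T$ of the set of points at which $G$ acts properly discontinuously. A point $p\in T$ is parabolic if $|\Lambda(\mathrm{Stab}_G\,p)|=1$, where $\mathrm{Stab}_G\,p$ is the stabilizer. Floyd function: $f:\mathbb Z_{>0}\to\mathbb R_{>0}$ (with $f(0):=f(1)$) such that for some $K>0$, $1\le f(n)/f(n+1)\le K$ for all $n$, and $\sum_n f(n)<\infty$. For a locally finite connected graph $\Gamma$ with base vertex $v$ and path distance $d$, the Floyd length of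 an edge $\{x,y\}$ is $f(d(v,\{x,y\}))$, the Floyd length of a path is the sum over its edges, and the Floyd distance $\delta_v$ between vertices is the infimum of Floyd lengths of paths joining them. The Floyd completion $\overline\Gamma_f$ is the Cauchy completion of $(\Gamma^0,\delta_v)$; it is compact and independent of $v$. The Floyd boundary is $\partial_f\Gamma=\overline\Gamma_f\setminus\Gamma^0$. For a finitely generated group $G$, $\overline G_f=G\sqcup\partial_fG$ is the Floyd completion of its Cayley graph with respect to a fixed finite generating set; left multiplication extends to an action of $G$ on $\overline G_f$ by homeomorphisms, and $G$ is an open discrete subset of $\overline G_f$. The function $f_0$ and the Floyd map: by a known theorem of Gerasimov, for an action as in the claim there are $\lambda\in\,]0,1[$ and a continuous $G$-equivariant map $F_0:\partial_{f_0}G\to T$, $f_0(n)=\lambda^n$, obtained as follows. There is a locally finite connected graph $\mathcal G$ on which $G$ acts with finitely many orbits of vertices and edges, and a compact Hausdorff topology on $M=T\sqcup\mathcal G^0$ inducing the given topology on $T$ and the discrete topology on the set of vertices $\mathcal G^0$, such that $G$ acts $3$-discontinuously on $M$. A $G$-equivariant quasi-isometric map $\psi:G\to\mathcal G^0$ extends to a continuous $G$-equivariant map $\overline G_{f_0}\to M$ whose restriction to $\partial_{f_0}G$ is $F_0$. Such $\lambda$ and $F_0$ are fixed. For a Floyd function $f\ge f_0$, the identity of $G$ extends to a continuous $G$-equivariant map $\chi:\partial_fG\to\partial_{f_0}G$, and $F:=F_0\circ\chi:\partial_fG\to T$ is called the Floyd map. *)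

theory Defs
  imports "HOL-Analysis.Analysis" "HOL-Algebra.Group_Action" "HOL-Algebra.Generated_Groups"
begin

section \<open>Quotient topology and spaces of subsets\<close>

definition quotient_topology :: "'a topology \<Rightarrow> ('a \<Rightarrow> 'b) \<Rightarrow> 'b topology" where
  "quotient_topology X q =
     topology (\<lambda>U. U \<subseteq> q ` topspace X \<and> openin X {x \<in> topspace X. q x \<in> U})"

lemma openin_quotient_topology:
  "openin (quotient_topology X q) U \<longleftrightarrow>
     U \<subseteq> q ` topspace X \<and> openin X {x \<in> topspace X. q x \<in> U}"
proof -
  have "istopology (\<lambda>U. U \<subseteq> q ` topspace X \<and> openin X {x \<in> topspace X. q x \<in> U})"
    unfolding istopology_def
  proof (intro conjI allI impI)
    fix U V
    assume U: "U \<subseteq> q ` topspace X \<and> openin X {x \<in> topspace X. q x \<in> U}"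
       and V: "V \<subseteq> q ` topspace X \<and> openin X {x \<in> topspace X. q x \<in> V}"
    have "{x \<in> topspace X. q x \<in> U \<inter> V} =
          {x \<in> topspace X. q x \<in> U} \<inter> {x \<in> topspace X. q x \<in> V}" by auto
    with U V show "openin X {x \<in> topspace X. q x \<in> U \<inter> V}" by auto
    show "U \<inter> V \<subseteq> q ` topspace X" using U by blast
  next
    fix \<K> assume K: "\<forall>K\<in>\<K>. K \<subseteq> q ` topspace X \<and> openin X {x \<in> topspace X. q x \<in> K}"
    have "{x \<in> topspace X. q x \<in> \<Union>\<K>} = (\<Union>K\<in>\<K>. {x \<in> topspace X. q x \<in> K})" by auto
    with K show "openin X {x \<in> topspace X. q x \<in> \<Union>\<K>}" by auto
    show "\<Union>\<K> \<subseteq> q ` topspace X" using K by blast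
  qed
  then show ?thesis by (simp add: quotient_topology_def topology_inverse')
qed

lemma topspace_quotient_topology: "topspace (quotient_topology X q) = q ` topspace X"
proof
  show "topspace (quotient_topology X q) \<subseteq> q ` topspace X"
    using openin_topspace[of "quotient_topology X q"] unfolding openin_quotient_topology by blast
  have "{x \<in> topspace X. q x \<in> q ` topspace X} = topspace X" by auto
  then have "openin (quotient_topology X q) (q ` topspace X)"
    by (simp add: openin_quotient_topology)
  then show "q ` topspace X \<subseteq> topspace (quotient_topology X q)"
    by (rule openin_subset)
qed

lemma quotient_map_quotient_topology: "quotient_map X (quotient_topology X q) q"
  unfolding quotient_map_def
  by (auto simp: topspace_quotient_topology openin_quotient_topology)

definition theta :: "nat \<Rightarrow> 'a topology \<Rightarrow> 'a set topology" where
  "theta n X =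
     quotient_topology
       (subtopology (product_topology (\<lambda>_. X) {..<n}) {x. inj_on x {..<n}})
       (\<lambda>x. x ` {..<n})"

lemma topspace_theta:
  "topspace (theta n X) = {A. A \<subseteq> topspace X \<and> finite A \<and> card A = n}"
proof (intro Set.set_eqI iffI)
  fix A assume "A \<in> topspace (theta n X)"
  then obtain x where x: "x \<in> (\<Pi>\<^sub>E i\<in>{..<n}. topspace X)" "inj_on x {..<n}" "A = x ` {..<n}"
    by (auto simp: theta_def topspace_quotient_topology)
  then show "A \<in> {A. A \<subseteq> topspace X \<and> finite A \<and> card A = n}"
    by (auto simp: card_image PiE_iff)
next
  fix A assume "A \<in> {A. A \<subseteq> topspace X \<and> finite A \<and> card A = n}"
  then have A: "A \<subseteq> topspace X" "finite A" "card A = n" by auto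
  then obtain h where h: "bij_betw h {..<n} A"
    using ex_bij_betw_nat_finite[of A] by (auto simp: atLeast0LessThan)
  let ?x = "restrict h {..<n}"
  have "inj_on ?x {..<n}" "?x ` {..<n} = A" 
    using h by (auto simp: bij_betw_def inj_on_restrict_eq)
  moreover have "?x \<in> (\<Pi>\<^sub>E i\<in>{..<n}. topspace X)"
    using h A by (auto simp: bij_betw_def)
  ultimately show "A \<in> topspace (theta n X)"
    unfolding theta_def topspace_quotient_topology
    by (intro image_eqI[of _ _ ?x]) simp_all
qed


section \<open>Group actions on spaces\<close>

definition acts_by_homeos :: "('g, 'm) monoid_scheme \<Rightarrow> 'a topology \<Rightarrow> ('g \<Rightarrow> 'a \<Rightarrow> 'a) \<Rightarrow> bool" where
  "acts_by_homeos G X \<phi> \<longleftrightarrow>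
     group_action G (topspace X) \<phi> \<and> (\<forall>g\<in>carrier G. homeomorphic_map X X (\<phi> g))"

definition properly_discontinuous ::
    "('g, 'm) monoid_scheme \<Rightarrow> 'a topology \<Rightarrow> ('g \<Rightarrow> 'a \<Rightarrow> 'a) \<Rightarrow> bool" where
  "properly_discontinuous G X \<phi> \<longleftrightarrow>
     (\<forall>K L. compactin X K \<and> compactin X L \<longrightarrow> finite {g \<in> carrier G. \<phi> g ` K \<inter> L \<noteq> {}})"

definition three_discontinuous ::
    "('g, 'm) monoid_scheme \<Rightarrow> 'a topology \<Rightarrow> ('g \<Rightarrow> 'a \<Rightarrow> 'a) \<Rightarrow> bool" where
  "three_discontinuous G X \<phi> \<longleftrightarrow> properly_discontinuous G (theta 3 X) (\<lambda>g A. \<phi> g ` A)"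

definition two_cocompact ::
    "('g, 'm) monoid_scheme \<Rightarrow> 'a topology \<Rightarrow> ('g \<Rightarrow> 'a \<Rightarrow> 'a) \<Rightarrow> bool" where
  "two_cocompact G X \<phi> \<longleftrightarrow>
     compact_space (quotient_topology (theta 2 X) (orbit G (\<lambda>g A. \<phi> g ` A)))"

text \<open>The limit set of a set \<open>H\<close> of group elements (a subgroup in all uses), acting through the
  restriction of \<open>\<phi>\<close>.\<close>

definition properly_discontinuous_at ::
    "'g set \<Rightarrow> 'a topology \<Rightarrow> ('g \<Rightarrow> 'a \<Rightarrow> 'a) \<Rightarrow> 'a \<Rightarrow> bool" where
  "properly_discontinuous_at H X \<phi> x \<longleftrightarrow>
     (\<exists>U. openin X U \<and> x \<in> U \<and> finite {h \<in> H. \<phi> h ` U \<inter> U \<noteq> {}})"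

definition limit_set :: "'g set \<Rightarrow> 'a topology \<Rightarrow> ('g \<Rightarrow> 'a \<Rightarrow> 'a) \<Rightarrow> 'a set" where
  "limit_set H X \<phi> = topspace X - {x \<in> topspace X. properly_discontinuous_at H X \<phi> x}"

definition parabolic_point ::
    "('g, 'm) monoid_scheme \<Rightarrow> 'a topology \<Rightarrow> ('g \<Rightarrow> 'a \<Rightarrow> 'a) \<Rightarrow> 'a \<Rightarrow> bool" where
  "parabolic_point G X \<phi> p \<longleftrightarrow>
     p \<in> topspace X \<and> card (limit_set (stabilizer G \<phi> p) X \<phi>) = 1"


section \<open>Cauchy completion of a metric space\<close>

definition cauchy_equiv :: "'a set \<Rightarrow> ('a \<Rightarrow> 'a \<Rightarrow> real) \<Rightarrow> ((nat \<Rightarrow> 'a) \<times> (nat \<Rightarrow> 'a)) set" where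
  "cauchy_equiv M d =
     {(s, t). Metric_space.MCauchy M d s \<and> Metric_space.MCauchy M d t \<and>
              (\<lambda>n. d (s n) (t n)) \<longlonglongrightarrow> 0}"

definition cauchy_completion :: "'a set \<Rightarrow> ('a \<Rightarrow> 'a \<Rightarrow> real) \<Rightarrow> (nat \<Rightarrow> 'a) set set" where
  "cauchy_completion M d = {s. Metric_space.MCauchy M d s} // cauchy_equiv M d"

text \<open>The locale \<^locale>\<open>Metric_space\<close> demands nonnegativity and symmetry also off the carrier, whence
  the value \<open>0\<close> there.\<close>

definition completion_dist ::
    "'a set \<Rightarrow> ('a \<Rightarrow> 'a \<Rightarrow> real) \<Rightarrow> (nat \<Rightarrow> 'a) set \<Rightarrow> (nat \<Rightarrow> 'a) set \<Rightarrow> real" where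
  "completion_dist M d \<xi> \<eta> =
     (if \<xi> \<in> cauchy_completion M d \<and> \<eta> \<in> cauchy_completion M d
      then THE r. \<forall>s\<in>\<xi>. \<forall>t\<in>\<eta>. (\<lambda>n. d (s n) (t n)) \<longlonglongrightarrow> r
      else 0)"

definition completion_topology ::
    "'a set \<Rightarrow> ('a \<Rightarrow> 'a \<Rightarrow> real) \<Rightarrow> (nat \<Rightarrow> 'a) set topology" where
  "completion_topology M d = Metric_space.mtopology (cauchy_completion M d) (completion_dist M d)"

definition completion_embed ::
    "'a set \<Rightarrow> ('a \<Rightarrow> 'a \<Rightarrow> real) \<Rightarrow> 'a \<Rightarrow> (nat \<Rightarrow> 'a) set" where
  "completion_embed M d x = cauchy_equiv M d `` {\<lambda>_. x}"

context Metric_space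
begin

lemma convergent_dist_Cauchy:
  assumes s: "MCauchy s" and t: "MCauchy t"
  shows "convergent (\<lambda>n. d (s n) (t n))"
proof -
  have sM: "s n \<in> M" and tM: "t n \<in> M" for n using s t by (auto simp: MCauchy_def)
  have "Cauchy (\<lambda>n. d (s n) (t n))"
  proof (rule metric_CauchyI)
    fix e :: real assume "e > 0"
    then have "e/2 > 0" by simp
    then obtain N1 N2 where N1: "\<And>n n'. \<lbrakk>N1 \<le> n; N1 \<le> n'\<rbrakk> \<Longrightarrow> d (s n) (s n') < e/2"
      and N2: "\<And>n n'. \<lbrakk>N2 \<le> n; N2 \<le> n'\<rbrakk> \<Longrightarrow> d (t n) (t n') < e/2"
      using s t unfolding MCauchy_def by meson
    have "dist (d (s m) (t m)) (d (s n) (t n)) < e" if "m \<ge> max N1 N2" "n \<ge> max N1 N2" for m n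
    proof -
      have "d (s m) (t m) \<le> d (s m) (s n) + d (s n) (t n) + d (t n) (t m)"
        using triangle[OF sM[of m] sM[of n] tM[of m]] triangle[OF sM[of n] tM[of n] tM[of m]] by simp
      moreover have "d (s n) (t n) \<le> d (s n) (s m) + d (s m) (t m) + d (t m) (t n)"
        using triangle[OF sM[of n] sM[of m] tM[of n]] triangle[OF sM[of m] tM[of m] tM[of n]] by simp
      moreover have "d (s m) (s n) < e/2" "d (s n) (s m) < e/2" "d (t m) (t n) < e/2" "d (t n) (t m) < e/2"
        using that N1[of m n] N1[of n m] N2[of m n] N2[of n m] by auto
      ultimately show ?thesis unfolding dist_real_def by linarith
    qed
    then show "\<exists>K. \<forall>m\<ge>K. \<forall>n\<ge>K. dist (d (s m) (t m)) (d (s n) (t n)) < e" by blast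
  qed
  then show ?thesis by (rule Cauchy_convergent)
qed

lemma equiv_cauchy_equiv: "equiv {s. MCauchy s} (cauchy_equiv M d)"
proof (rule equivI)
  show "cauchy_equiv M d \<subseteq> {s. MCauchy s} \<times> {s. MCauchy s}"
    by (auto simp: cauchy_equiv_def)
  show "refl_on {s. MCauchy s} (cauchy_equiv M d)"
    unfolding refl_on_def cauchy_equiv_def by (auto simp: MCauchy_def subset_iff)
  show "sym (cauchy_equiv M d)"
    unfolding sym_def cauchy_equiv_def by (simp add: commute)
  show "trans (cauchy_equiv M d)"
  proof (rule transI)
    fix s t u assume st: "(s, t) \<in> cauchy_equiv M d" and tu: "(t, u) \<in> cauchy_equiv M d"
    then have C: "MCauchy s" "MCauchy t" "MCauchy u" by (auto simp: cauchy_equiv_def)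
    have "(\<lambda>n. d (s n) (t n) + d (t n) (u n)) \<longlonglongrightarrow> 0 + 0"
      using st tu by (intro tendsto_add) (auto simp: cauchy_equiv_def)
    then have "(\<lambda>n. d (s n) (u n)) \<longlonglongrightarrow> 0"
    proof -
      assume lim: "(\<lambda>n. d (s n) (t n) + d (t n) (u n)) \<longlonglongrightarrow> 0 + 0"
      have "d (s n) (u n) \<le> d (s n) (t n) + d (t n) (u n)" for n
        using C by (intro triangle) (auto simp: MCauchy_def)
      then show ?thesis
        by (intro tendsto_sandwich[OF always_eventually always_eventually tendsto_const lim[simplified]])
           simp_all
    qed
    then show "(s, u) \<in> cauchy_equiv M d" using C by (simp add: cauchy_equiv_def)
  qed
qed

lemma completion_dist_tendsto:
  assumes \<xi>: "\<xi> \<in> cauchy_completion M d" and \<eta>: "\<eta> \<in> cauchy_completion M d"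
    and "s \<in> \<xi>" "t \<in> \<eta>"
  shows "(\<lambda>n. d (s n) (t n)) \<longlonglongrightarrow> completion_dist M d \<xi> \<eta>"
proof -
  have mem: "(a, b) \<in> cauchy_equiv M d" 
    if "\<zeta> \<in> cauchy_completion M d" "a \<in> \<zeta>" "b \<in> \<zeta>" for \<zeta> a b
    using that quotient_eq_iff[OF equiv_cauchy_equiv] unfolding cauchy_completion_def by blast
  have C: "MCauchy s" "MCauchy t"
    using mem[OF \<xi> \<open>s \<in> \<xi>\<close> \<open>s \<in> \<xi>\<close>] mem[OF \<eta> \<open>t \<in> \<eta>\<close> \<open>t \<in> \<eta>\<close>] by (auto simp: cauchy_equiv_def)
  then obtain r where r: "(\<lambda>n. d (s n) (t n)) \<longlonglongrightarrow> r"
    using convergent_dist_Cauchy by (auto simp: convergent_def)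
  have all: "\<forall>s'\<in>\<xi>. \<forall>t'\<in>\<eta>. (\<lambda>n. d (s' n) (t' n)) \<longlonglongrightarrow> r"
  proof (intro ballI)
    fix s' t' assume "s' \<in> \<xi>" "t' \<in> \<eta>"
    then have s': "(s, s') \<in> cauchy_equiv M d" and t': "(t, t') \<in> cauchy_equiv M d"
      using mem[OF \<xi> \<open>s \<in> \<xi>\<close>] mem[OF \<eta> \<open>t \<in> \<eta>\<close>] by auto
    have M: "s n \<in> M" "t n \<in> M" "s' n \<in> M" "t' n \<in> M" for n
      using s' t' by (auto simp: cauchy_equiv_def MCauchy_def)
    have lim: "(\<lambda>n. d (s n) (s' n) + d (t n) (t' n)) \<longlonglongrightarrow> 0 + 0"
      using s' t' by (intro tendsto_add) (auto simp: cauchy_equiv_def)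
    have "\<bar>d (s' n) (t' n) - d (s n) (t n)\<bar> \<le> d (s n) (s' n) + d (t n) (t' n)" for n
      using triangle[OF M(3)[of n] M(1)[of n] M(4)[of n]] triangle[OF M(1)[of n] M(2)[of n] M(4)[of n]]
        triangle[OF M(1)[of n] M(3)[of n] M(2)[of n]] triangle[OF M(3)[of n] M(4)[of n] M(2)[of n]]
        commute[of "s n" "s' n"] commute[of "t n" "t' n"] by linarith
    then have "(\<lambda>n. d (s' n) (t' n) - d (s n) (t n)) \<longlonglongrightarrow> 0"
      by (intro Lim_null_comparison[OF always_eventually lim[simplified]]) simp
    from tendsto_add[OF this r] show "(\<lambda>n. d (s' n) (t' n)) \<longlonglongrightarrow> r" by simp
  qed
  have "completion_dist M d \<xi> \<eta> = r"
  proof -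
    have "(THE r. \<forall>s\<in>\<xi>. \<forall>t\<in>\<eta>. (\<lambda>n. d (s n) (t n)) \<longlonglongrightarrow> r) = r"
      using all LIMSEQ_unique[OF _ r] \<open>s \<in> \<xi>\<close> \<open>t \<in> \<eta>\<close> by (intro the_equality) blast+
    then show ?thesis using \<xi> \<eta> by (simp add: completion_dist_def)
  qed
  with r show ?thesis by simp
qed

lemma cauchy_completion_nonempty:
  assumes "\<xi> \<in> cauchy_completion M d"
  shows "\<exists>s. s \<in> \<xi> \<and> MCauchy s"
proof -
  obtain s where "MCauchy s" "\<xi> = cauchy_equiv M d `` {s}"
    using assms unfolding cauchy_completion_def by (auto elim: quotientE)
  then show ?thesis
    using equiv_class_self[OF equiv_cauchy_equiv] by auto
qed

lemma Metric_space_completion: "Metric_space (cauchy_completion M d) (completion_dist M d)"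
proof -
  let ?C = "cauchy_completion M d" and ?D = "completion_dist M d"
  have nonneg: "0 \<le> ?D \<xi> \<eta>" if C: "\<xi> \<in> ?C" "\<eta> \<in> ?C" for \<xi> \<eta>
  proof -
    obtain s t where "s \<in> \<xi>" "t \<in> \<eta>" using C[THEN cauchy_completion_nonempty] by blast
    then have "(\<lambda>n. d (s n) (t n)) \<longlonglongrightarrow> ?D \<xi> \<eta>" using completion_dist_tendsto[OF C] by blast
    then show ?thesis by (rule LIMSEQ_le_const) simp
  qed
  have zero: "?D \<xi> \<eta> = 0 \<longleftrightarrow> \<xi> = \<eta>" if C: "\<xi> \<in> ?C" "\<eta> \<in> ?C" for \<xi> \<eta>
  proof -
    obtain s t where st: "s \<in> \<xi>" "t \<in> \<eta>" "MCauchy s" "MCauchy t"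
      using C[THEN cauchy_completion_nonempty] by blast
    have "?D \<xi> \<eta> = 0 \<longleftrightarrow> (s, t) \<in> cauchy_equiv M d"
      using completion_dist_tendsto[OF that st(1,2)] st(3,4)
      by (auto simp: cauchy_equiv_def intro: LIMSEQ_unique)
    also have "\<dots> \<longleftrightarrow> \<xi> = \<eta>"
      using quotient_eq_iff[OF equiv_cauchy_equiv _ _ st(1,2)] that
      unfolding cauchy_completion_def by blast
    finally show ?thesis .
  qed
  have tri: "?D \<xi> \<zeta> \<le> ?D \<xi> \<eta> + ?D \<eta> \<zeta>" if C: "\<xi> \<in> ?C" "\<eta> \<in> ?C" "\<zeta> \<in> ?C" for \<xi> \<eta> \<zeta>
  proof -
    obtain s t u where st: "s \<in> \<xi>" "t \<in> \<eta>" "u \<in> \<zeta>" "MCauchy s" "MCauchy t" "MCauchy u"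
      using C[THEN cauchy_completion_nonempty] by blast
    have "(\<lambda>n. d (s n) (u n)) \<longlonglongrightarrow> ?D \<xi> \<zeta>"
      and "(\<lambda>n. d (s n) (t n) + d (t n) (u n)) \<longlonglongrightarrow> ?D \<xi> \<eta> + ?D \<eta> \<zeta>"
      using that st by (auto intro!: tendsto_add completion_dist_tendsto)
    moreover have "d (s n) (u n) \<le> d (s n) (t n) + d (t n) (u n)" for n
      using st by (intro triangle) (auto simp: MCauchy_def)
    ultimately show ?thesis using LIMSEQ_le by blast
  qed
  have sym: "?D \<xi> \<eta> = ?D \<eta> \<xi>" for \<xi> \<eta>
  proof (cases "\<xi> \<in> ?C \<and> \<eta> \<in> ?C")
    case True
    then obtain s t where "s \<in> \<xi>" "t \<in> \<eta>" using cauchy_completion_nonempty by blast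
    then show ?thesis
      using completion_dist_tendsto[of \<xi> \<eta> s t] completion_dist_tendsto[of \<eta> \<xi> t s] True
      by (auto simp: commute intro: LIMSEQ_unique)
  next
    case False
    then show ?thesis by (auto simp: completion_dist_def)
  qed
  have "0 \<le> ?D \<xi> \<eta>" for \<xi> \<eta>
    using nonneg[of \<xi> \<eta>] by (cases "\<xi> \<in> ?C \<and> \<eta> \<in> ?C") (auto simp: completion_dist_def)
  then show ?thesis
    using sym zero tri by unfold_locales auto
qed

lemma MCauchy_const: "x \<in> M \<Longrightarrow> MCauchy (\<lambda>_. x)"
  by (auto simp: MCauchy_def)

lemma completion_embed_in:
  assumes "x \<in> M" shows "completion_embed M d x \<in> cauchy_completion M d"
  using MCauchy_const[OF assms] unfolding completion_embed_def cauchy_completion_def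
  by (auto intro: quotientI)

lemma completion_dist_embed:
  assumes x: "x \<in> M" and y: "y \<in> M"
  shows "completion_dist M d (completion_embed M d x) (completion_embed M d y) = d x y"
proof -
  have "(\<lambda>_. x) \<in> completion_embed M d x" "(\<lambda>_. y) \<in> completion_embed M d y"
    using MCauchy_const[OF x] MCauchy_const[OF y] equiv_class_self[OF equiv_cauchy_equiv]
    by (auto simp: completion_embed_def)
  from completion_dist_tendsto[OF completion_embed_in[OF x] completion_embed_in[OF y] this]
  show ?thesis by (simp add: LIMSEQ_const_iff)
qed

end


section \<open>Graphs and Floyd completions\<close>

definition simple_graph :: "'v set \<Rightarrow> 'v set set \<Rightarrow> bool" where
  "simple_graph V E \<longleftrightarrow> (\<forall>e\<in>E. e \<subseteq> V \<and> card e = 2)"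

definition locally_finite_graph :: "'v set \<Rightarrow> 'v set set \<Rightarrow> bool" where
  "locally_finite_graph V E \<longleftrightarrow> (\<forall>v\<in>V. finite {e \<in> E. v \<in> e})"

definition graph_path :: "'v set set \<Rightarrow> 'v \<Rightarrow> 'v list \<Rightarrow> 'v \<Rightarrow> bool" where
  "graph_path E x xs y \<longleftrightarrow>
     xs \<noteq> [] \<and> hd xs = x \<and> last xs = y \<and> successively (\<lambda>a b. {a, b} \<in> E) xs"

definition connected_graph :: "'v set \<Rightarrow> 'v set set \<Rightarrow> bool" where
  "connected_graph V E \<longleftrightarrow> (\<forall>x\<in>V. \<forall>y\<in>V. \<exists>xs. graph_path E x xs y)"

definition graph_dist :: "'v set set \<Rightarrow> 'v \<Rightarrow> 'v \<Rightarrow> nat" where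
  "graph_dist E x y = Inf {length xs - 1 | xs. graph_path E x xs y}"

text \<open>A Floyd function is defined on the positive integers only: no condition involves \<open>f 0\<close>, and
  the convention \<open>f(0) := f(1)\<close> appears as \<open>max 1\<close> in the length of an edge.\<close>

definition floyd_function :: "(nat \<Rightarrow> real) \<Rightarrow> bool" where
  "floyd_function f \<longleftrightarrow>
     (\<forall>n\<ge>1. f n > 0) \<and>
     (\<exists>K>0. \<forall>n\<ge>1. 1 \<le> f n / f (n + 1) \<and> f n / f (n + 1) \<le> K) \<and>
     summable (\<lambda>n. f (n + 1))"

definition floyd_edge_length :: "(nat \<Rightarrow> real) \<Rightarrow> 'v set set \<Rightarrow> 'v \<Rightarrow> 'v set \<Rightarrow> real" where
  "floyd_edge_length f E v e = f (max 1 (Min (graph_dist E v ` e)))"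

definition floyd_length :: "(nat \<Rightarrow> real) \<Rightarrow> 'v set set \<Rightarrow> 'v \<Rightarrow> 'v list \<Rightarrow> real" where
  "floyd_length f E v xs = (\<Sum>(a, b)\<leftarrow>zip xs (tl xs). floyd_edge_length f E v {a, b})"

definition floyd_dist ::
    "(nat \<Rightarrow> real) \<Rightarrow> 'v set \<Rightarrow> 'v set set \<Rightarrow> 'v \<Rightarrow> 'v \<Rightarrow> 'v \<Rightarrow> real" where
  "floyd_dist f V E v x y =
     (if x \<in> V \<and> y \<in> V then Inf {floyd_length f E v xs | xs. graph_path E x xs y} else 0)"

lemma graph_path_rev: "graph_path E x xs y \<Longrightarrow> graph_path E y (rev xs) x"
  by (auto simp: graph_path_def hd_rev last_rev insert_commute)

lemma floyd_length_Cons: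
  "xs \<noteq> [] \<Longrightarrow> floyd_length f E v (x # xs) = floyd_edge_length f E v {x, hd xs} + floyd_length f E v xs"
  by (cases xs) (auto simp: floyd_length_def)

lemma floyd_length_append:
  "\<lbrakk>xs \<noteq> []; ys \<noteq> []; last xs = hd ys\<rbrakk> \<Longrightarrow>
     floyd_length f E v (xs @ tl ys) = floyd_length f E v xs + floyd_length f E v ys"
proof (induction xs)
  case (Cons x xs)
  show ?case
  proof (cases "xs = []")
    case True
    with Cons.prems have "[x] @ tl ys = ys" by (cases ys) auto
    with True show ?thesis by (simp add: floyd_length_def)
  next
    case False
    with Cons show ?thesis by (simp add: floyd_length_Cons)
  qed
qed simp

lemma floyd_length_rev: "floyd_length f E v (rev xs) = floyd_length f E v xs"
proof (induction xs)
  case (Cons x xs)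
  show ?case
  proof (cases "xs = []")
    case False
    then have "floyd_length f E v (rev xs @ tl [hd xs, x]) = 
               floyd_length f E v (rev xs) + floyd_length f E v [hd xs, x]"
      by (intro floyd_length_append) (auto simp: last_rev)
    with False Cons show ?thesis
      by (simp add: floyd_length_Cons) (simp add: floyd_length_def insert_commute)
  qed (simp add: floyd_length_def)
qed (simp add: floyd_length_def)

lemma graph_path_append:
  assumes "graph_path E x xs y" "graph_path E y ys z"
  shows "graph_path E x (xs @ tl ys) z"
proof (cases ys)
  case (Cons a as)
  with assms show ?thesis
    by (cases as) (auto simp: graph_path_def successively_append_iff)
qed (use assms in \<open>auto simp: graph_path_def\<close>)

lemma Metric_space_floyd:
  assumes G: "simple_graph V E" "connected_graph V E" "locally_finite_graph V E"
    and f: "floyd_function f"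
  shows "Metric_space V (floyd_dist f V E v)"
proof -
  have epos: "0 < floyd_edge_length f E v e" for e
    using f by (simp add: floyd_edge_length_def floyd_function_def)
  have lnn: "0 \<le> floyd_length f E v xs" for xs
    unfolding floyd_length_def using epos
    by (intro sum_list_nonneg) (auto simp: less_imp_le)
  define L where "L x y = {floyd_length f E v xs | xs. graph_path E x xs y}" for x y
  have D: "floyd_dist f V E v x y = Inf (L x y)" if "x \<in> V" "y \<in> V" for x y
    using that by (simp add: floyd_dist_def L_def)
  have ne: "L x y \<noteq> {}" if "x \<in> V" "y \<in> V" for x y
    using G(2) that by (auto simp: connected_graph_def L_def)
  have bdd: "bdd_below (L x y)" for x y
    using lnn by (auto simp: L_def intro!: bdd_belowI[of _ 0])
  have nonneg: "0 \<le> floyd_dist f V E v x y" for x y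
    using ne[of x y] lnn by (cases "x \<in> V \<and> y \<in> V") (auto simp: D L_def floyd_dist_def intro!: cInf_greatest)
  have "L x y \<subseteq> L y x" for x y
    unfolding L_def using graph_path_rev[of E x _ y] floyd_length_rev[of f E v, symmetric] by blast
  then have sym: "floyd_dist f V E v x y = floyd_dist f V E v y x" for x y
    using D by (metis floyd_dist_def subset_antisym)
  have tri: "floyd_dist f V E v x z \<le> floyd_dist f V E v x y + floyd_dist f V E v y z"
    if V: "x \<in> V" "y \<in> V" "z \<in> V" for x y z
  proof -
    have *: "Inf (L x z) \<le> a + b" if ab: "a \<in> L x y" "b \<in> L y z" for a b
    proof -
      obtain xs ys where xs: "graph_path E x xs y" "a = floyd_length f E v xs"
        and ys: "graph_path E y ys z" "b = floyd_length f E v ys" using ab by (auto simp: L_def)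
      then have "a + b = floyd_length f E v (xs @ tl ys)"
        by (subst floyd_length_append) (auto simp: graph_path_def)
      then have "a + b \<in> L x z" using graph_path_append[OF xs(1) ys(1)] by (auto simp: L_def)
      then show ?thesis using bdd by (rule cInf_lower)
    qed
    have "Inf (L x z) - b \<le> Inf (L x y)" if "b \<in> L y z" for b
      using *[OF _ that] ne[OF V(1,2)] by (intro cInf_greatest) (auto simp: algebra_simps)
    then have "Inf (L x z) - Inf (L x y) \<le> Inf (L y z)"
      using ne[OF V(2,3)] by (intro cInf_greatest) (auto simp: algebra_simps)
    then show ?thesis using V by (simp add: D)
  qed
  have pos: "0 < floyd_dist f V E v x y" if V: "x \<in> V" "y \<in> V" and "x \<noteq> y" for x y
  proof -
    define A where "A = insert 1 (floyd_edge_length f E v ` {e \<in> E. x \<in> e})"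
    have A: "finite A" "A \<noteq> {}" using G(3) V by (auto simp: A_def locally_finite_graph_def)
    have "Min A > 0" using A epos by (auto simp: A_def)
    moreover have "Min A \<le> Inf (L x y)"
    proof (rule cInf_greatest[OF ne[OF V]])
      fix l assume "l \<in> L x y"
      then obtain xs where xs: "graph_path E x xs y" "l = floyd_length f E v xs" by (auto simp: L_def)
      with \<open>x \<noteq> y\<close> obtain b ys where b: "xs = x # b # ys" 
        by (cases xs; cases "tl xs") (auto simp: graph_path_def)
      with xs have "{x, b} \<in> E" by (auto simp: graph_path_def)
      then have "Min A \<le> floyd_edge_length f E v {x, b}" using A by (intro Min_le) (auto simp: A_def)
      also have "\<dots> \<le> l" using xs b lnn by (simp add: floyd_length_Cons)
      finally show "Min A \<le> l" .
    qed
    ultimately show ?thesis using V by (simp add: D)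
  qed
  have refl: "floyd_dist f V E v x x = 0" if "x \<in> V" for x
  proof -
    have "0 \<in> L x x" unfolding L_def
      by (rule CollectI, rule exI[of _ "[x]"]) (auto simp: graph_path_def floyd_length_def)
    then have "Inf (L x x) \<le> 0" using bdd by (rule cInf_lower)
    then show ?thesis using nonneg[of x x] that by (simp add: D)
  qed
  show ?thesis
    by unfold_locales (use nonneg sym tri pos refl in \<open>auto simp: less_le\<close>, metis less_irrefl pos)
qed

text \<open>The Cayley graph has an edge from \<open>g\<close> to \<open>g s\<close>, so that left multiplication acts on it; loops
  are dropped.  The base vertex of its Floyd completion is the identity.\<close>

definition cayley_edges :: "('g, 'm) monoid_scheme \<Rightarrow> 'g set \<Rightarrow> 'g set set" where
  "cayley_edges G S = {{g, g \<otimes>\<^bsub>G\<^esub> s} | g s. g \<in> carrier G \<and> s \<in> S \<and> g \<otimes>\<^bsub>G\<^esub> s \<noteq> g}"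

definition group_floyd_dist ::
    "('g, 'm) monoid_scheme \<Rightarrow> 'g set \<Rightarrow> (nat \<Rightarrow> real) \<Rightarrow> 'g \<Rightarrow> 'g \<Rightarrow> real" where
  "group_floyd_dist G S f = floyd_dist f (carrier G) (cayley_edges G S) \<one>\<^bsub>G\<^esub>"

definition floyd_completion ::
    "('g, 'm) monoid_scheme \<Rightarrow> 'g set \<Rightarrow> (nat \<Rightarrow> real) \<Rightarrow> (nat \<Rightarrow> 'g) set topology" where
  "floyd_completion G S f = completion_topology (carrier G) (group_floyd_dist G S f)"

definition floyd_embed ::
    "('g, 'm) monoid_scheme \<Rightarrow> 'g set \<Rightarrow> (nat \<Rightarrow> real) \<Rightarrow> 'g \<Rightarrow> (nat \<Rightarrow> 'g) set" where
  "floyd_embed G S f = completion_embed (carrier G) (group_floyd_dist G S f)"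

definition floyd_boundary ::
    "('g, 'm) monoid_scheme \<Rightarrow> 'g set \<Rightarrow> (nat \<Rightarrow> real) \<Rightarrow> (nat \<Rightarrow> 'g) set set" where
  "floyd_boundary G S f =
     topspace (floyd_completion G S f) - floyd_embed G S f ` carrier G"

text \<open>Left multiplication by \<open>g\<close> is bi-Lipschitz for the Floyd distance, hence maps each equivalence
  class of Cauchy sequences onto an equivalence class.\<close>

definition floyd_action :: "('g, 'm) monoid_scheme \<Rightarrow> 'g \<Rightarrow> (nat \<Rightarrow> 'g) set \<Rightarrow> (nat \<Rightarrow> 'g) set" where
  "floyd_action G g \<xi> = (\<lambda>s n. g \<otimes>\<^bsub>G\<^esub> s n) ` \<xi>"


section \<open>The Floyd map\<close>

definition cofinite_graph_action ::
    "('g, 'm) monoid_scheme \<Rightarrow> 'v set \<Rightarrow> 'v set set \<Rightarrow> ('g \<Rightarrow> 'v \<Rightarrow> 'v) \<Rightarrow> bool" where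
  "cofinite_graph_action G V E \<rho> \<longleftrightarrow>
     group_action G V \<rho> \<and> (\<forall>g\<in>carrier G. \<forall>e\<in>E. \<rho> g ` e \<in> E) \<and>
     finite (orbits G V \<rho>) \<and> finite (orbits G E (\<lambda>g e. \<rho> g ` e))"

definition quasi_isometric_map ::
    "'a set \<Rightarrow> ('a \<Rightarrow> 'a \<Rightarrow> nat) \<Rightarrow> ('b \<Rightarrow> 'b \<Rightarrow> nat) \<Rightarrow> ('a \<Rightarrow> 'b) \<Rightarrow> bool" where
  "quasi_isometric_map A d d' h \<longleftrightarrow>
     (\<exists>c\<ge>1::real. \<forall>x\<in>A. \<forall>y\<in>A.
        d x y / c - c \<le> d' (h x) (h y) \<and> d' (h x) (h y) \<le> c * d x y + c)"

text \<open>A compact Hausdorff topology on the disjoint union of the space \<open>X\<close> and the vertex set \<open>V\<close>,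
  inducing the topology of \<open>X\<close> and the discrete topology of \<open>V\<close>.\<close>

definition compact_sum_topology :: "'a topology \<Rightarrow> 'v set \<Rightarrow> ('a + 'v) topology \<Rightarrow> bool" where
  "compact_sum_topology X V M \<longleftrightarrow>
     topspace M = Inl ` topspace X \<union> Inr ` V \<and>
     compact_space M \<and> Hausdorff_space M \<and>
     embedding_map X M Inl \<and> embedding_map (discrete_topology V) M Inr"

definition sum_action ::
    "('a + 'v) topology \<Rightarrow> ('g \<Rightarrow> 'a \<Rightarrow> 'a) \<Rightarrow> ('g \<Rightarrow> 'v \<Rightarrow> 'v) \<Rightarrow> 'g \<Rightarrow> 'a + 'v \<Rightarrow> 'a + 'v" where
  "sum_action M \<phi> \<rho> g = restrict (map_sum (\<phi> g) (\<rho> g)) (topspace M)"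

text \<open>\<open>F\<^sub>0\<close> is a boundary map of the action \<open>\<phi>\<close> at the exponential function with ratio \<open>lam\<close>, obtained
  from the graph \<open>(V, E)\<close>, the space \<open>M\<close>, the orbit map \<open>\<psi>\<close> and its continuous extension \<open>\<Psi>\<close>.\<close>

definition exponential_floyd_map ::
    "('g, 'm) monoid_scheme \<Rightarrow> 'g set \<Rightarrow> 'a topology \<Rightarrow> ('g \<Rightarrow> 'a \<Rightarrow> 'a) \<Rightarrow> real \<Rightarrow>
     'v set \<Rightarrow> 'v set set \<Rightarrow> ('g \<Rightarrow> 'v \<Rightarrow> 'v) \<Rightarrow> ('a + 'v) topology \<Rightarrow>
     ('g \<Rightarrow> 'v) \<Rightarrow> ((nat \<Rightarrow> 'g) set \<Rightarrow> 'a + 'v) \<Rightarrow> ((nat \<Rightarrow> 'g) set \<Rightarrow> 'a) \<Rightarrow> bool" where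
  "exponential_floyd_map G S X \<phi> lam V E \<rho> M \<psi> \<Psi> F\<^sub>0 \<longleftrightarrow>
     simple_graph V E \<and> locally_finite_graph V E \<and> connected_graph V E \<and>
     cofinite_graph_action G V E \<rho> \<and>
     compact_sum_topology X V M \<and>
     acts_by_homeos G M (sum_action M \<phi> \<rho>) \<and>
     three_discontinuous G M (sum_action M \<phi> \<rho>) \<and>
     \<psi> ` carrier G \<subseteq> V \<and>
     (\<forall>g\<in>carrier G. \<forall>h\<in>carrier G. \<psi> (g \<otimes>\<^bsub>G\<^esub> h) = \<rho> g (\<psi> h)) \<and>
     quasi_isometric_map (carrier G) (graph_dist (cayley_edges G S)) (graph_dist E) \<psi> \<and>
     continuous_map (floyd_completion G S (\<lambda>n. lam ^ n)) M \<Psi> \<and>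
     (\<forall>g\<in>carrier G. \<Psi> (floyd_embed G S (\<lambda>n. lam ^ n) g) = Inr (\<psi> g)) \<and>
     (\<forall>g\<in>carrier G. \<forall>\<xi>\<in>topspace (floyd_completion G S (\<lambda>n. lam ^ n)).
        \<Psi> (floyd_action G g \<xi>) = sum_action M \<phi> \<rho> g (\<Psi> \<xi>)) \<and>
     (\<forall>\<xi>\<in>floyd_boundary G S (\<lambda>n. lam ^ n). F\<^sub>0 \<xi> \<in> topspace X \<and> \<Psi> \<xi> = Inl (F\<^sub>0 \<xi>))"

text \<open>Here \<open>chi\<close> is the (unique) continuous extension to the Floyd completions of the identity of \<open>G\<close>.\<close>

definition extends_identity ::
    "('g, 'm) monoid_scheme \<Rightarrow> 'g set \<Rightarrow> (nat \<Rightarrow> real) \<Rightarrow> (nat \<Rightarrow> real) \<Rightarrow>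
     ((nat \<Rightarrow> 'g) set \<Rightarrow> (nat \<Rightarrow> 'g) set) \<Rightarrow> bool" where
  "extends_identity G S f f\<^sub>0 chi \<longleftrightarrow>
     continuous_map (floyd_completion G S f) (floyd_completion G S f\<^sub>0) chi \<and>
     (\<forall>g\<in>carrier G. chi (floyd_embed G S f g) = floyd_embed G S f\<^sub>0 g)"

end

theory Submission
  imports Defs
begin

text \<open>By Karlsson's lemma a geodesic between Floyd-distant points passes near the identity. If two
  distinct boundary points have the same image \<open>p\<close>, the geodesics joining sequences that converge
  to them therefore all pass near the identity, while the orbit points of their ends tend to \<open>p\<close> in
  the compact space \<open>M\<close>; call \<open>g\<close> horocyclic for \<open>p\<close> if it lies on such geodesics. Karlsson's lemma
  also shows that an element which is horocyclic for a point near \<open>a\<close> has its orbit point near \<open>a\<close>,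
  up to finitely many exceptions. Hence only finitely many \<open>g\<close> are horocyclic for points of both of
  two disjoint closed sets, and 2-cocompactness leaves only finitely many points for which the
  identity is horocyclic. It follows that the elements that are horocyclic for \<open>p\<close> are at bounded
  distance from the stabilizer of \<open>p\<close>, and they accumulate at both boundary points. The dynamics of
  the stabilizer on \<open>M\<close> is controlled by 3-discontinuity, tested on triples that contain an isolated
  point. The exponential function matters only for the existence of the extension of the orbit map
  to the Floyd completion.\<close>

section \<open>Sequences in the Cauchy completion\<close>

context Metric_space
begin

interpretation completion: Metric_space "cauchy_completion M d" "completion_dist M d"
  by (rule Metric_space_completion)

abbreviation mcompletion :: "(nat \<Rightarrow> 'a) set topology" where
  "mcompletion \<equiv> completion_topology M d"

abbreviation membed :: "'a \<Rightarrow> (nat \<Rightarrow> 'a) set" where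
  "membed \<equiv> completion_embed M d"

abbreviation mclass :: "(nat \<Rightarrow> 'a) \<Rightarrow> (nat \<Rightarrow> 'a) set" where
  "mclass s \<equiv> cauchy_equiv M d `` {s}"

lemma topspace_mcompletion: "topspace mcompletion = cauchy_completion M d"
  by (simp add: completion_topology_def)

lemma Hausdorff_space_mcompletion: "Hausdorff_space mcompletion"
  unfolding completion_topology_def by (rule completion.Hausdorff_space_mtopology)

lemma inj_on_membed: "inj_on membed M"
proof (rule inj_onI)
  fix x y assume M: "x \<in> M" "y \<in> M" and "membed x = membed y"
  then have "d x y = d x x" using completion_dist_embed by metis
  then show "x = y" using M by simp
qed

definition approaches :: "(nat \<Rightarrow> 'a) \<Rightarrow> (nat \<Rightarrow> 'a) set \<Rightarrow> bool" where
  "approaches s a \<longleftrightarrow> range s \<subseteq> M \<and> limitin mcompletion (\<lambda>n. membed (s n)) a sequentially"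

lemma approaches_in: "approaches s a \<Longrightarrow> s n \<in> M"
  by (auto simp: approaches_def)

lemma approaches_in_completion: "approaches s a \<Longrightarrow> a \<in> cauchy_completion M d"
  by (auto simp: approaches_def topspace_mcompletion dest: limitin_topspace)

lemma approaches_iff_dist_tendsto_0:
  "approaches s a \<longleftrightarrow> range s \<subseteq> M \<and> a \<in> cauchy_completion M d \<and>
     (\<lambda>n. completion_dist M d (membed (s n)) a) \<longlonglongrightarrow> 0"
  unfolding approaches_def completion_topology_def completion.limitin_metric_dist_null
  by (auto intro!: always_eventually completion_embed_in)

lemma approaches_mclass:
  assumes s: "MCauchy s"
  shows "approaches s (mclass s)"
proof -
  have sM: "range s \<subseteq> M" using s by (simp add: MCauchy_def)
  have in_completion: "mclass s \<in> cauchy_completion M d"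
    using s unfolding cauchy_completion_def by (auto intro: quotientI)
  have dist_class: "(\<lambda>m. d (s n) (s m)) \<longlonglongrightarrow> completion_dist M d (membed (s n)) (mclass s)" for n
  proof (rule completion_dist_tendsto[OF completion_embed_in in_completion])
    show "s n \<in> M" using sM by blast
    then show "(\<lambda>_. s n) \<in> membed (s n)"
      unfolding completion_embed_def using MCauchy_const
      by (intro equiv_class_self[OF equiv_cauchy_equiv]) simp
    show "s \<in> mclass s" using s by (intro equiv_class_self[OF equiv_cauchy_equiv]) simp
  qed
  have "(\<lambda>n. completion_dist M d (membed (s n)) (mclass s)) \<longlonglongrightarrow> 0"
  proof (rule LIMSEQ_I)
    fix e :: real assume "e > 0"
    then obtain N where N: "\<And>n n'. \<lbrakk>N \<le> n; N \<le> n'\<rbrakk> \<Longrightarrow> d (s n) (s n') < e / 2"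
      using s half_gt_zero[of e] unfolding MCauchy_def by meson
    have "completion_dist M d (membed (s n)) (mclass s) \<le> e / 2" if "N \<le> n" for n
      by (rule LIMSEQ_le_const2[OF dist_class]) (use N[OF that] in \<open>blast intro: less_imp_le\<close>)
    then show "\<exists>N. \<forall>n\<ge>N. norm (completion_dist M d (membed (s n)) (mclass s) - 0) < e"
      using \<open>e > 0\<close> by (intro exI[of _ N]) fastforce
  qed
  then show ?thesis using sM in_completion by (simp add: approaches_iff_dist_tendsto_0)
qed

lemma approaches_const: "x \<in> M \<Longrightarrow> approaches (\<lambda>_. x) (membed x)"
  unfolding completion_embed_def by (intro approaches_mclass MCauchy_const)

lemma ex_approaches:
  assumes "a \<in> cauchy_completion M d"
  shows "\<exists>s. approaches s a"
  using assms approaches_mclass unfolding cauchy_completion_def by (auto elim!: quotientE)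

lemma approaches_compose:
  assumes "approaches s a" "filterlim r at_top sequentially"
  shows "approaches (s \<circ> r) a"
  using assms unfolding approaches_def limitin_def
  by (auto dest: eventually_compose_filterlim)

lemma approaches_dist_tendsto:
  assumes s: "approaches s a" and t: "approaches t b"
  shows "(\<lambda>n. d (s n) (t n)) \<longlonglongrightarrow> completion_dist M d a b"
proof -
  let ?D = "completion_dist M d"
  have C: "a \<in> cauchy_completion M d" "b \<in> cauchy_completion M d"
    "membed (s n) \<in> cauchy_completion M d" "membed (t n) \<in> cauchy_completion M d" for n
    using assms by (auto intro: approaches_in approaches_in_completion completion_embed_in)
  have isometry: "d (s n) (t n) = ?D (membed (s n)) (membed (t n))" for n
    using assms by (simp add: completion_dist_embed approaches_in)
  have bound: "norm (d (s n) (t n) - ?D a b) \<le> ?D (membed (s n)) a + ?D (membed (t n)) b" for n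
    using completion.triangle[OF C(3)[of n] C(1) C(4)[of n]]
      completion.triangle[OF C(1) C(2) C(4)[of n]]
      completion.triangle[OF C(1) C(3)[of n] C(2)]
      completion.triangle[OF C(3)[of n] C(4)[of n] C(2)]
      completion.commute[of a "membed (s n)"] completion.commute[of b "membed (t n)"]
    unfolding real_norm_def isometry by linarith
  have "(\<lambda>n. ?D (membed (s n)) a + ?D (membed (t n)) b) \<longlonglongrightarrow> 0"
    using assms by (auto simp: approaches_iff_dist_tendsto_0 intro: tendsto_add_zero)
  with always_eventually have "(\<lambda>n. d (s n) (t n) - ?D a b) \<longlonglongrightarrow> 0"
    by (rule Lim_null_comparison) (use bound in blast)
  then show ?thesis by (rule LIM_zero_cancel)
qed

lemma approaches_if_dist_tendsto_0:
  assumes s: "approaches s a" and t: "range t \<subseteq> M" and st: "(\<lambda>n. d (s n) (t n)) \<longlonglongrightarrow> 0"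
  shows "approaches t a"
proof -
  have a: "a \<in> cauchy_completion M d" by (rule approaches_in_completion[OF s])
  have M: "s n \<in> M" "t n \<in> M" for n using s t by (auto simp: approaches_def)
  have bound: "completion_dist M d (membed (t n)) a
      \<le> d (s n) (t n) + completion_dist M d (membed (s n)) a" for n
    using completion.triangle[OF completion_embed_in[OF M(2)] completion_embed_in[OF M(1)] a]
    by (metis M commute completion_dist_embed)
  have "(\<lambda>n. d (s n) (t n) + completion_dist M d (membed (s n)) a) \<longlonglongrightarrow> 0"
    using s st by (auto simp: approaches_iff_dist_tendsto_0 intro: tendsto_add_zero)
  with always_eventually have "(\<lambda>n. completion_dist M d (membed (t n)) a) \<longlonglongrightarrow> 0"
    by (rule Lim_null_comparison) (use bound in simp)
  then show ?thesis using a t by (simp add: approaches_iff_dist_tendsto_0)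
qed

lemma continuous_map_limitin_if_approaches:
  assumes "continuous_map mcompletion Y h" "approaches s a"
  shows "limitin Y (\<lambda>n. h (membed (s n))) (h a) sequentially"
  using continuous_map_limit[OF assms(1)] assms(2) by (fastforce simp: approaches_def o_def)

lemma mtotally_bounded_approaches:
  fixes s :: "nat \<Rightarrow> 'a"
  assumes "mtotally_bounded H" "range s \<subseteq> H"
  obtains r a where "strict_mono r" "approaches (s \<circ> r) a"
  using assms approaches_mclass unfolding mtotally_bounded_sequentially by blast

lemma openin_mcompletion_membed:
  assumes x: "x \<in> M" and isolated: "openin mtopology {x}"
  shows "openin mcompletion {membed x}"
proof -
  obtain r where r: "r > 0" "mball x r \<subseteq> {x}" using isolated by (auto simp: openin_mtopology)
  have "completion.mball (membed x) r \<subseteq> {membed x}"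
  proof
    fix a assume a: "a \<in> completion.mball (membed x) r"
    then obtain s where s: "approaches s a" using ex_approaches by auto
    have lim: "(\<lambda>n. d x (s n)) \<longlonglongrightarrow> completion_dist M d (membed x) a"
      by (rule approaches_dist_tendsto[OF approaches_const[OF x] s])
    then have "\<forall>\<^sub>F n in sequentially. d x (s n) < r"
      by (rule order_tendstoD(2)) (use a in simp)
    then have "\<forall>\<^sub>F n in sequentially. d x (s n) = 0"
      by (rule eventually_mono) (use r(2) x approaches_in[OF s] in force)
    then have "completion_dist M d (membed x) a = 0"
      by (intro LIMSEQ_unique[OF lim] tendsto_eventually)
    then show "a \<in> {membed x}" using a by auto
  qed
  then have "completion.mball (membed x) r = {membed x}" using x r(1) completion_embed_in by auto
  then show ?thesis unfolding completion_topology_def by (metis completion.openin_mball)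
qed

lemma approaches_membed_eventually_eq:
  assumes s: "approaches s (membed x)" and x: "x \<in> M" and isolated: "openin mtopology {x}"
  shows "\<forall>\<^sub>F n in sequentially. s n = x"
proof -
  have "\<forall>\<^sub>F n in sequentially. membed (s n) \<in> {membed x}"
    using s openin_mcompletion_membed[OF x isolated] by (auto simp: approaches_def limitin_def)
  then show ?thesis
    by (rule eventually_mono) (use inj_on_membed x approaches_in[OF s] in \<open>auto dest: inj_onD\<close>)
qed

lemma approaches_eventually_notin_finite:
  assumes s: "approaches s a" and a: "a \<notin> membed ` M" and K: "finite K"
  shows "\<forall>\<^sub>F n in sequentially. s n \<notin> K"
proof -
  let ?K = "membed ` (K \<inter> M)"
  have "closedin mcompletion ?K"
    using K Hausdorff_space_mcompletion completion_embed_in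
    by (intro closedin_Hausdorff_finite) (auto simp: topspace_mcompletion)
  then have "openin mcompletion (topspace mcompletion - ?K)"
    by (rule openin_diff[OF openin_topspace])
  moreover have "a \<in> topspace mcompletion - ?K"
    using approaches_in_completion[OF s] a by (auto simp: topspace_mcompletion)
  ultimately have "\<forall>\<^sub>F n in sequentially. membed (s n) \<in> topspace mcompletion - ?K"
    using s unfolding approaches_def limitin_def by blast
  then show ?thesis by (rule eventually_mono) (use approaches_in[OF s] in auto)
qed

lemma infinite_range_if_approaches:
  assumes "approaches s a" "a \<notin> membed ` M"
  shows "infinite (range s)"
  using approaches_eventually_notin_finite[OF assms, of "range s"] by auto

lemma in_closure_of_membed_iff:
  assumes H: "H \<subseteq> M"
  shows "a \<in> mcompletion closure_of (membed ` H) \<longleftrightarrow> (\<exists>s. range s \<subseteq> H \<and> approaches s a)"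
proof
  note closure = completion.closure_of_sequentially[folded completion_topology_def]
  show "\<exists>s. range s \<subseteq> H \<and> approaches s a" if a: "a \<in> mcompletion closure_of (membed ` H)"
  proof -
    obtain \<sigma> where \<sigma>: "range \<sigma> \<subseteq> membed ` H" "limitin mcompletion \<sigma> a sequentially"
      using a unfolding closure by auto
    then have "\<forall>n. \<exists>h. h \<in> H \<and> \<sigma> n = membed h" by blast
    then obtain s where "\<forall>n. s n \<in> H \<and> \<sigma> n = membed (s n)" by metis
    then have "range s \<subseteq> H" "\<sigma> = (\<lambda>n. membed (s n))" by auto
    then show ?thesis using \<sigma>(2) H by (intro exI[of _ s]) (simp add: approaches_def)
  qed
  show "a \<in> mcompletion closure_of (membed ` H)" if ex: "\<exists>s. range s \<subseteq> H \<and> approaches s a"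
  proof -
    obtain s where s: "range s \<subseteq> H" "approaches s a" using ex by blast
    then have "range (\<lambda>n. membed (s n)) \<subseteq> membed ` H \<inter> cauchy_completion M d"
      using H completion_embed_in by auto
    then show ?thesis
      unfolding closure using s(2) approaches_in_completion[OF s(2)]
      by (intro CollectI conjI exI[of _ "\<lambda>n. membed (s n)"]) (simp_all add: approaches_def)
  qed
qed

lemma in_frontier_of_membed_iff:
  assumes discrete: "mtopology = discrete_topology M" and H: "H \<subseteq> M"
  shows "a \<in> mcompletion frontier_of (membed ` H) \<longleftrightarrow>
    a \<notin> membed ` M \<and> (\<exists>s. range s \<subseteq> H \<and> approaches s a)"
proof -
  have isolated: "openin mtopology {x}" if "x \<in> M" for x using that by (simp add: discrete)
  have "openin mcompletion (\<Union>x\<in>H. {membed x})"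
    using H by (intro openin_Union) (auto intro: openin_mcompletion_membed isolated)
  then have "mcompletion interior_of (membed ` H) = membed ` H"
    by (simp add: interior_of_openin UNION_singleton_eq_range)
  moreover have "a \<in> membed ` H" if "a \<in> membed ` M" "range s \<subseteq> H" "approaches s a" for s
  proof -
    obtain x where x: "x \<in> M" "a = membed x" using \<open>a \<in> membed ` M\<close> by blast
    have "\<forall>\<^sub>F n in sequentially. s n = x"
      using approaches_membed_eventually_eq[OF _ x(1) isolated[OF x(1)]] x(2) that(3) by blast
    then have "x \<in> H" using that(2) eventually_happens'[OF sequentially_bot] by blast
    then show ?thesis using x(2) by blast
  qed
  ultimately show ?thesis
    using H by (auto simp: frontier_of_def in_closure_of_membed_iff)
qed

lemma infinite_if_in_frontier_of_membed:
  assumes "mtopology = discrete_topology M" "H \<subseteq> M" "a \<in> mcompletion frontier_of (membed ` H)"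
  shows "infinite H"
proof -
  obtain s where "range s \<subseteq> H" "approaches s a" "a \<notin> membed ` M"
    using assms by (auto simp: in_frontier_of_membed_iff)
  then show ?thesis using infinite_range_if_approaches finite_subset by blast
qed

lemma frontier_of_membed_nonempty:
  assumes discrete: "mtopology = discrete_topology M" and H: "mtotally_bounded H" "infinite H"
  shows "mcompletion frontier_of (membed ` H) \<noteq> {}"
proof -
  have HM: "H \<subseteq> M" using H(1) by (rule mtotally_bounded_imp_subset)
  obtain h :: "nat \<Rightarrow> 'a" where h: "inj h" "range h \<subseteq> H"
    using infinite_countable_subset[OF H(2)] by blast
  obtain r a where r: "strict_mono r" "approaches (h \<circ> r) a"
    using mtotally_bounded_approaches[OF H(1) h(2)] .
  have inj: "inj (h \<circ> r)" using h(1) strict_mono_imp_inj_on[OF r(1)] by (rule inj_compose)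
  have "a \<noteq> membed x" if x: "x \<in> M" for x
  proof
    assume "a = membed x"
    then have "\<forall>\<^sub>F n in sequentially. (h \<circ> r) n = x"
      using approaches_membed_eventually_eq[of "h \<circ> r" x] r(2) x by (simp add: discrete)
    then obtain N where "\<And>n. n \<ge> N \<Longrightarrow> (h \<circ> r) n = x" by (auto simp: eventually_sequentially)
    from this[of N] this[of "Suc N"] show False using injD[OF inj, of N "Suc N"] by simp
  qed
  moreover have "range (h \<circ> r) \<subseteq> H" using h(2) by auto
  ultimately have "a \<in> mcompletion frontier_of (membed ` H)"
    using r(2) unfolding in_frontier_of_membed_iff[OF discrete HM] by blast
  then show ?thesis by blast
qed

end


section \<open>Geodesics in graphs\<close>

lemma graph_dist_le: "graph_path E x xs y \<Longrightarrow> graph_dist E x y \<le> length xs - 1"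
  unfolding graph_dist_def by (rule cInf_lower) auto

lemma ex_shortest_graph_path:
  assumes "connected_graph V E" "x \<in> V" "y \<in> V"
  shows "\<exists>xs. graph_path E x xs y \<and> length xs = Suc (graph_dist E x y)"
proof -
  let ?L = "{length xs - 1 | xs. graph_path E x xs y}"
  have "?L \<noteq> {}" using assms by (auto simp: connected_graph_def)
  then have "graph_dist E x y \<in> ?L" unfolding graph_dist_def by (rule Inf_nat_def1)
  then obtain xs where xs: "graph_path E x xs y" "graph_dist E x y = length xs - 1" by blast
  then have "length xs = Suc (graph_dist E x y)" by (simp add: graph_path_def)
  with xs(1) show ?thesis by blast
qed

lemma graph_dist_self [simp]: "graph_dist E x x = 0"
  using graph_dist_le[of E x "[x]" x] by (simp add: graph_path_def)

lemma graph_dist_commute: "graph_dist E x y = graph_dist E y x"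
proof -
  have subset: "{length xs - 1 | xs. graph_path E x xs y}
      \<subseteq> {length xs - 1 | xs. graph_path E y xs x}" for x y
    by clarsimp (metis graph_path_rev length_rev)
  show ?thesis unfolding graph_dist_def by (rule arg_cong[OF subset_antisym[OF subset subset]])
qed

lemma graph_dist_edge_le: "{x, y} \<in> E \<Longrightarrow> graph_dist E x y \<le> 1"
  using graph_dist_le[of E x "[x, y]" y] by (simp add: graph_path_def)

locale connected_simple_graph =
  fixes V :: "'v set" and E :: "'v set set"
  assumes simple: "simple_graph V E" and connected: "connected_graph V E"
begin

lemma edge_in: "{x, y} \<in> E \<Longrightarrow> x \<in> V \<and> y \<in> V"
  using simple by (auto simp: simple_graph_def)

lemma graph_dist_triangle:
  assumes "x \<in> V" "y \<in> V" "z \<in> V"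
  shows "graph_dist E x z \<le> graph_dist E x y + graph_dist E y z"
proof -
  obtain xs ys where "graph_path E x xs y" "length xs = Suc (graph_dist E x y)"
    "graph_path E y ys z" "length ys = Suc (graph_dist E y z)"
    using ex_shortest_graph_path[OF connected] assms by meson
  then show ?thesis
    using graph_dist_le[OF graph_path_append[of E x xs y ys z]] by simp
qed

lemma graph_dist_eq_0_iff:
  assumes "x \<in> V" "y \<in> V"
  shows "graph_dist E x y = 0 \<longleftrightarrow> x = y"
proof
  assume "graph_dist E x y = 0"
  then obtain xs where "graph_path E x xs y" "length xs = Suc 0"
    using ex_shortest_graph_path[OF connected assms] by auto
  then show "x = y" by (auto simp: graph_path_def length_Suc_conv)
qed simp

lemma ex_neighbour_towards:
  assumes "x \<in> V" "y \<in> V" "graph_dist E x y = Suc n"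
  obtains u where "{x, u} \<in> E" "graph_dist E x u = 1" "graph_dist E u y = n"
proof -
  obtain xs where xs: "graph_path E x xs y" "length xs = Suc (Suc n)"
    using ex_shortest_graph_path[OF connected assms(1,2)] assms(3) by auto
  then obtain u ys where ys: "xs = x # u # ys" by (auto simp: graph_path_def length_Suc_conv)
  with xs have edge: "{x, u} \<in> E" and path: "graph_path E u (u # ys) y"
    by (auto simp: graph_path_def)
  have "graph_dist E x u \<le> 1" using edge by (rule graph_dist_edge_le)
  moreover have "graph_dist E u y \<le> n" using graph_dist_le[OF path] xs ys by simp
  moreover have "Suc n \<le> graph_dist E x u + graph_dist E u y"
    using graph_dist_triangle[of x u y] assms edge_in[OF edge] by simp
  ultimately show thesis using that edge by simp
qed

definition between :: "'v \<Rightarrow> 'v \<Rightarrow> 'v \<Rightarrow> bool" where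
  "between x u y \<longleftrightarrow>
     {x, u, y} \<subseteq> V \<and> graph_dist E x u + graph_dist E u y = graph_dist E x y"

lemma between_in: "between x u y \<Longrightarrow> x \<in> V \<and> u \<in> V \<and> y \<in> V"
  by (simp add: between_def)

lemma between_commute: "between x u y \<longleftrightarrow> between y u x"
  unfolding between_def
  by (auto simp: graph_dist_commute[of E x] graph_dist_commute[of E u y] add.commute)

lemma between_left_end: "x \<in> V \<Longrightarrow> y \<in> V \<Longrightarrow> between x x y"
  by (simp add: between_def)

lemma between_neighbour:
  assumes "{x, u} \<in> E" "y \<in> V" "graph_dist E x u = 1" "Suc (graph_dist E u y) = graph_dist E x y"
  shows "between x u y"
  using assms edge_in by (simp add: between_def)

lemma between_trans_right:
  assumes "between x z y" "between z u y"
  shows "between x u y" and "between x z u"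
  using assms graph_dist_triangle[of x z u] graph_dist_triangle[of x u y]
  by (auto simp: between_def)

lemma between_trans_left:
  assumes "between x z y" "between x u z"
  shows "between x u y" and "between u z y"
  using between_trans_right[of y z x u] assms by (auto simp: between_commute)

lemma ex_between_at_dist:
  assumes "x \<in> V" "y \<in> V" "k \<le> graph_dist E x y"
  shows "\<exists>u. between x u y \<and> graph_dist E x u = k"
  using assms(3)
proof (induction k)
  case 0
  then show ?case using between_left_end[OF assms(1,2)] by auto
next
  case (Suc k)
  then obtain u where u: "between x u y" "graph_dist E x u = k" by auto
  with Suc.prems have "graph_dist E u y = Suc (graph_dist E x y - Suc k)"
    unfolding between_def by linarith
  then obtain w where w: "{u, w} \<in> E" "graph_dist E u w = 1"
      "Suc (graph_dist E w y) = graph_dist E u y"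
    using ex_neighbour_towards[of u y] between_in[OF u(1)] by metis
  then have "between u w y" using between_in[OF u(1)] by (intro between_neighbour) auto
  from between_trans_right[OF u(1) this] have "between x w y" "between x u w" .
  then show ?case using u(2) w(2) by (auto simp: between_def)
qed

lemma finite_graph_ball:
  assumes "locally_finite_graph V E" "v \<in> V"
  shows "finite {x \<in> V. graph_dist E v x \<le> r}"
proof (induction r)
  case 0
  have "{x \<in> V. graph_dist E v x \<le> 0} \<subseteq> {v}" using graph_dist_eq_0_iff assms(2) by auto
  then show ?case by (rule finite_subset) simp
next
  case (Suc r)
  let ?B = "{x \<in> V. graph_dist E v x \<le> r}"
  let ?N = "\<Union>u\<in>?B. {e \<in> E. u \<in> e}"
  have "{x \<in> V. graph_dist E v x \<le> Suc r} \<subseteq> ?B \<union> \<Union> ?N"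
  proof (clarify, rule ccontr)
    fix x assume x: "x \<in> V" "graph_dist E v x \<le> Suc r" "x \<notin> \<Union> ?N" "\<not> graph_dist E v x \<le> r"
    then have "graph_dist E x v = Suc r" by (simp add: graph_dist_commute)
    then obtain u where "{x, u} \<in> E" "graph_dist E u v = r"
      using ex_neighbour_towards x(1) assms(2) by blast
    then have "x \<in> \<Union> ?N" using edge_in by (fastforce simp: graph_dist_commute)
    with x(3) show False ..
  qed
  moreover have "finite ?N"
    using Suc assms(1) by (intro finite_UN_I) (auto simp: locally_finite_graph_def)
  moreover have "finite e" if "e \<in> ?N" for e
    using that simple by (auto simp: simple_graph_def intro: card_ge_0_finite)
  ultimately show ?case using Suc by (meson finite_Un finite_Union finite_subset)
qed

end


section \<open>Floyd functions\<close>

lemma floyd_function_pos: "floyd_function f \<Longrightarrow> 1 \<le> n \<Longrightarrow> 0 < f n"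
  by (simp add: floyd_function_def)

lemma floyd_function_antimono:
  assumes f: "floyd_function f" and "1 \<le> m" "m \<le> n"
  shows "f n \<le> f m"
  using \<open>m \<le> n\<close>
proof (induction rule: dec_induct)
  case (step k)
  have "1 \<le> k" using step.hyps(1) \<open>1 \<le> m\<close> by (rule order_trans[rotated])
  then have "1 \<le> f k / f (k + 1)" using f unfolding floyd_function_def by blast
  then have "f (Suc k) \<le> f k" using floyd_function_pos[OF f, of "k + 1"] by (simp add: field_simps)
  with step.IH show ?case by simp
qed simp

text \<open>A geodesic whose point closest to the base point is at distance \<open>D\<close> from it is, \<open>j\<close> steps
  after this point, at distance at least \<open>max D (j - D)\<close>, hence at least \<open>(D + j) / 3\<close>, from the
  base point.\<close>

definition floyd_third :: "(nat \<Rightarrow> real) \<Rightarrow> nat \<Rightarrow> real" where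
  "floyd_third f j = f (max 1 (j div 3))"

definition floyd_tail :: "(nat \<Rightarrow> real) \<Rightarrow> nat \<Rightarrow> real" where
  "floyd_tail f D = (\<Sum>j. floyd_third f (D + j))"

context
  fixes f :: "nat \<Rightarrow> real"
  assumes f: "floyd_function f"
begin

lemma floyd_third_pos: "0 < floyd_third f j"
  using f by (simp add: floyd_third_def floyd_function_pos)

lemma summable_floyd_third: "summable (floyd_third f)"
proof (rule bounded_imp_summable)
  let ?g = "\<lambda>n. f (max 1 n)"
  have "summable (\<lambda>n. ?g (Suc n))" using f by (simp add: floyd_function_def)
  then have summable: "summable ?g" by (rule summable_Suc_iff[THEN iffD1])
  have thirds: "(\<Sum>j<3 * n. floyd_third f j) = 3 * (\<Sum>k<n. ?g k)" for n
  proof (induction n)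
    case (Suc n)
    have "3 * Suc n = Suc (Suc (Suc (3 * n)))" by simp
    moreover have "Suc (3 * n) div 3 = n" "Suc (Suc (3 * n)) div 3 = n" by presburger+
    ultimately show ?case using Suc by (simp only: sum.lessThan_Suc) (simp add: floyd_third_def)
  qed simp
  show "0 \<le> floyd_third f j" for j using floyd_third_pos[of j] by simp
  show "(\<Sum>j\<le>n. floyd_third f j) \<le> 3 * (\<Sum>k. ?g k)" for n
  proof -
    have "(\<Sum>j\<le>n. floyd_third f j) \<le> (\<Sum>j<3 * Suc n. floyd_third f j)"
      by (rule sum_mono2) (auto intro: less_imp_le floyd_third_pos)
    also have "\<dots> = 3 * (\<Sum>k<Suc n. ?g k)" by (rule thirds)
    also have "\<dots> \<le> 3 * (\<Sum>k. ?g k)"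
      using sum_le_suminf[OF summable, of "{..<Suc n}"] floyd_function_pos[OF f]
      by (simp add: less_imp_le)
    finally show ?thesis .
  qed
qed

lemma sum_le_floyd_tail: "(\<Sum>j<n. floyd_third f (D + j)) \<le> floyd_tail f D"
  unfolding floyd_tail_def
  using summable_ignore_initial_segment[OF summable_floyd_third, of D] floyd_third_pos
  by (intro sum_le_suminf) (auto simp: add.commute less_imp_le)

lemma floyd_tail_tendsto_0: "floyd_tail f \<longlonglongrightarrow> 0"
  using suminf_exist_split2[OF summable_floyd_third]
  by (simp add: floyd_tail_def[abs_def] add.commute)

lemma tendsto_0_if_le_floyd_tail:
  assumes "filterlim D at_top sequentially"
    and "\<forall>\<^sub>F n in sequentially. 0 \<le> x n \<and> x n \<le> floyd_tail f (D n)"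
  shows "x \<longlonglongrightarrow> 0"
proof (rule Lim_null_comparison)
  show "(\<lambda>n. floyd_tail f (D n)) \<longlonglongrightarrow> 0"
    by (rule filterlim_compose[OF floyd_tail_tendsto_0 assms(1)])
  show "\<forall>\<^sub>F n in sequentially. norm (x n) \<le> floyd_tail f (D n)"
    using assms(2) by (rule eventually_mono) simp
qed

end


section \<open>Floyd distance and geodesics\<close>

lemma infinite_eventually:
  fixes I :: "nat set"
  assumes "infinite I" "eventually P sequentially"
  shows "infinite {n \<in> I. P n}"
proof
  assume "finite {n \<in> I. P n}"
  moreover have "finite {n. \<not> P n}"
    using assms(2) by (simp add: eventually_cofinite flip: cofinite_eq_sequentially)
  moreover have "I \<subseteq> {n \<in> I. P n} \<union> {n. \<not> P n}" by blast
  ultimately show False using assms(1) by (meson finite_Un finite_subset)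
qed

locale floyd_graph = connected_simple_graph V E for V :: "'v set" and E +
  fixes v :: 'v and f :: "nat \<Rightarrow> real"
  assumes locally_finite: "locally_finite_graph V E" and base: "v \<in> V" and f: "floyd_function f"
begin

abbreviation depth :: "'v \<Rightarrow> nat" where
  "depth \<equiv> graph_dist E v"

abbreviation fdist :: "'v \<Rightarrow> 'v \<Rightarrow> real" where
  "fdist \<equiv> floyd_dist f V E v"

sublocale floyd: Metric_space V fdist
  by (rule Metric_space_floyd[OF simple connected locally_finite f])

lemma depth_le: "x \<in> V \<Longrightarrow> y \<in> V \<Longrightarrow> depth y \<le> depth x + graph_dist E x y"
  by (rule graph_dist_triangle[OF base])

lemma graph_dist_le_depth: "x \<in> V \<Longrightarrow> y \<in> V \<Longrightarrow> graph_dist E x y \<le> depth x + depth y"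
  using graph_dist_triangle[OF _ base] by (metis graph_dist_commute)

lemma floyd_length_nonneg: "0 \<le> floyd_length f E v xs"
  unfolding floyd_length_def floyd_edge_length_def using floyd_function_pos[OF f]
  by (intro sum_list_nonneg) (auto simp: less_imp_le)

lemma floyd_dist_le_length:
  assumes "x \<in> V" "y \<in> V" "graph_path E x xs y"
  shows "fdist x y \<le> floyd_length f E v xs"
  using assms floyd_length_nonneg unfolding floyd_dist_def
  by (auto intro!: cInf_lower bdd_belowI[of _ 0])

lemma floyd_dist_edge_le:
  assumes "{x, y} \<in> E"
  shows "fdist x y \<le> f (max 1 (min (depth x) (depth y)))"
proof -
  have "floyd_length f E v [x, y] = f (max 1 (min (depth x) (depth y)))"
    by (simp add: floyd_length_def floyd_edge_length_def)
  then show ?thesis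
    using floyd_dist_le_length[of x y "[x, y]"] assms edge_in[OF assms]
    by (simp add: graph_path_def)
qed

lemma floyd_dist_ge:
  assumes V: "x \<in> V" "y \<in> V" and "x \<noteq> y"
  shows "f (max 1 (depth x)) \<le> fdist x y"
proof -
  have "f (max 1 (depth x)) \<le> floyd_length f E v xs" if path: "graph_path E x xs y" for xs
  proof -
    obtain u ys where xs: "xs = x # u # ys"
      using path \<open>x \<noteq> y\<close> by (cases xs; cases "tl xs") (auto simp: graph_path_def)
    have "f (max 1 (depth x)) \<le> f (max 1 (min (depth x) (depth u)))"
      by (rule floyd_function_antimono[OF f]) auto
    also have "\<dots> = floyd_edge_length f E v {x, u}" by (simp add: floyd_edge_length_def)
    also have "\<dots> \<le> floyd_length f E v xs"
      using xs floyd_length_nonneg by (simp add: floyd_length_Cons)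
    finally show ?thesis .
  qed
  moreover have "\<exists>xs. graph_path E x xs y" using connected V by (simp add: connected_graph_def)
  ultimately show ?thesis using V unfolding floyd_dist_def by (auto intro!: cInf_greatest)
qed

lemma floyd_mtopology_eq_discrete: "floyd.mtopology = discrete_topology V"
proof -
  have "openin floyd.mtopology {x}" if x: "x \<in> V" for x
  proof -
    have "0 < f (max 1 (depth x))" using floyd_function_pos[OF f] by simp
    moreover have "floyd.mball x (f (max 1 (depth x))) \<subseteq> {x}"
      using floyd_dist_ge by (force simp: not_less)
    ultimately show ?thesis using x by (auto simp: floyd.openin_mtopology)
  qed
  then show ?thesis by (metis discrete_topology_unique floyd.topspace_mtopology)
qed

lemma floyd_dist_le_sum:
  "\<lbrakk>x \<in> V; y \<in> V; graph_dist E x y = n;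
    \<And>u. between x u y \<Longrightarrow> (D + graph_dist E x u) div 3 \<le> depth u\<rbrakk> \<Longrightarrow>
    fdist x y \<le> (\<Sum>j<n. floyd_third f (D + j))"
proof (induction n arbitrary: x D)
  case 0
  then show ?case using graph_dist_eq_0_iff by simp
next
  case (Suc n)
  obtain u where u: "{x, u} \<in> E" "graph_dist E x u = 1" "graph_dist E u y = n"
    using ex_neighbour_towards[OF Suc.prems(1-3)] by blast
  then have uV: "u \<in> V" using edge_in by blast
  have xuy: "between x u y" using u Suc.prems by (intro between_neighbour) auto
  have "fdist u y \<le> (\<Sum>j<n. floyd_third f (Suc D + j))"
  proof (rule Suc.IH[OF uV Suc.prems(2) u(3)])
    fix w assume "between u w y"
    note xwy = between_trans_right(1)[OF xuy this] and xuw = between_trans_right(2)[OF xuy this]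
    have "Suc D + graph_dist E u w = D + graph_dist E x w" using xuw u(2) by (simp add: between_def)
    then show "(Suc D + graph_dist E u w) div 3 \<le> depth w" using Suc.prems(4)[OF xwy] by simp
  qed
  moreover have "fdist x u \<le> floyd_third f D"
  proof -
    have "D div 3 \<le> depth x" using Suc.prems(4)[of x] between_left_end Suc.prems by simp
    moreover have "Suc D div 3 \<le> depth u" using Suc.prems(4)[OF xuy] u by simp
    moreover have "D div 3 \<le> Suc D div 3" by (rule div_le_mono) simp
    ultimately have "f (max 1 (min (depth x) (depth u))) \<le> floyd_third f D"
      unfolding floyd_third_def by (intro floyd_function_antimono[OF f]) auto
    then show ?thesis using floyd_dist_edge_le[OF u(1)] by simp
  qed
  moreover have "fdist x y \<le> fdist x u + fdist u y"
    using floyd.triangle uV Suc.prems by blast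
  moreover have "(\<Sum>j<Suc n. floyd_third f (D + j)) =
      floyd_third f D + (\<Sum>j<n. floyd_third f (Suc D + j))"
    by (subst sum.lessThan_Suc_shift) simp
  ultimately show ?case by linarith
qed

lemma floyd_dist_le_tail:
  assumes "x \<in> V" "y \<in> V" "\<And>u. between x u y \<Longrightarrow> D + graph_dist E x u \<le> 3 * depth u"
  shows "fdist x y \<le> floyd_tail f D"
proof -
  have "(D + graph_dist E x u) div 3 \<le> depth u" if "between x u y" for u
    using assms(3)[OF that] by linarith
  from floyd_dist_le_sum[OF assms(1,2) refl this] show ?thesis
    using sum_le_floyd_tail[OF f] by (rule order_trans)
qed

lemma floyd_dist_le_tail_if_near:
  assumes V: "x \<in> V" "y \<in> V" and near: "graph_dist E x y \<le> R" and deep: "2 * R \<le> depth x"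
  shows "fdist x y \<le> floyd_tail f (depth x)"
proof (rule floyd_dist_le_tail[OF V])
  fix u assume "between x u y"
  then have "graph_dist E x u \<le> R" "depth x \<le> depth u + graph_dist E x u"
    using near depth_le[of u x] graph_dist_commute[of E u x] by (auto simp: between_def)
  then show "depth x + graph_dist E x u \<le> 3 * depth u" using deep by linarith
qed

lemma floyd_dist_le_tail_along_geodesic:
  assumes szy: "between s z y" and far: "depth s \<le> graph_dist E s z"
  shows "fdist z y \<le> floyd_tail f (graph_dist E s z - depth s)"
proof (rule floyd_dist_le_tail)
  show "z \<in> V" "y \<in> V" using between_in[OF szy] by auto
  fix u assume zuy: "between z u y"
  have "graph_dist E s u \<le> depth s + depth u"
    using graph_dist_le_depth between_in szy zuy by blast
  moreover have "graph_dist E s z + graph_dist E z u = graph_dist E s u"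
    using between_trans_right(2)[OF szy zuy] by (simp add: between_def)
  ultimately show "graph_dist E s z - depth s + graph_dist E z u \<le> 3 * depth u"
    using far by linarith
qed

lemma floyd_dist_le_tail_from_nearest:
  assumes V: "z \<in> V" "y \<in> V" and nearest: "\<And>u. between z u y \<Longrightarrow> depth z \<le> depth u"
  shows "fdist z y \<le> floyd_tail f (depth z)"
proof (rule floyd_dist_le_tail[OF V])
  fix u assume "between z u y"
  then have "graph_dist E z u \<le> depth z + depth u" "depth z \<le> depth u"
    using graph_dist_le_depth between_in nearest by blast+
  then show "depth z + graph_dist E z u \<le> 3 * depth u" by linarith
qed

theorem karlsson_visibility:
  assumes "0 < e"
  shows "\<exists>R. \<forall>x\<in>V. \<forall>y\<in>V. e \<le> fdist x y \<longrightarrow> (\<exists>u. between x u y \<and> depth u \<le> R)"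
proof -
  have "\<forall>\<^sub>F D in sequentially. floyd_tail f D < e / 2"
    using floyd_tail_tendsto_0[OF f] by (rule order_tendstoD(2)) (use \<open>0 < e\<close> in simp)
  then obtain R where R: "\<And>D. R \<le> D \<Longrightarrow> floyd_tail f D < e / 2"
    by (auto simp: eventually_sequentially)
  have "\<exists>u. between x u y \<and> depth u \<le> R" if V: "x \<in> V" "y \<in> V" and le: "e \<le> fdist x y" for x y
  proof -
    obtain z where z: "between x z y" and nearest: "\<And>u. between x u y \<Longrightarrow> depth z \<le> depth u"
      using ex_has_least_nat[of "\<lambda>u. between x u y" x depth] between_left_end[OF V] by blast
    have zV: "z \<in> V" using between_in[OF z] by blast
    have "fdist z y \<le> floyd_tail f (depth z)"
      by (rule floyd_dist_le_tail_from_nearest[OF zV V(2)])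
        (rule nearest[OF between_trans_right(1)[OF z]])
    moreover have "fdist z x \<le> floyd_tail f (depth z)"
    proof (intro floyd_dist_le_tail_from_nearest zV V nearest)
      fix u assume "between z u x"
      then show "between x u y" by (rule between_trans_left(1)[OF z between_commute[THEN iffD1]])
    qed
    moreover have "fdist x y \<le> fdist z x + fdist z y"
      using floyd.triangle''[OF V(1) zV V(2)] by simp
    ultimately have "\<not> floyd_tail f (depth z) < e / 2" using le by linarith
    then show ?thesis using z R[of "depth z"] by (meson linorder_le_cases)
  qed
  then show ?thesis by blast
qed

lemma depth_le_if_between_both_ways:
  assumes "between x g y" "between x s g" "between g t y" "depth s \<le> R" "depth t \<le> R"
  shows "depth g \<le> 3 * R"
proof -
  have sgt: "between s g t"
    using between_trans_right(2)[OF between_trans_left(2)[OF assms(1,2)] assms(3)] .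
  then have V: "s \<in> V" "g \<in> V" "t \<in> V" using between_in by auto
  have "depth g \<le> depth s + graph_dist E s g" using V by (intro depth_le)
  moreover have "graph_dist E s g \<le> graph_dist E s t" using sgt by (simp add: between_def)
  moreover have "graph_dist E s t \<le> depth s + depth t" using V by (intro graph_dist_le_depth)
  ultimately show ?thesis using assms(4,5) by linarith
qed

lemma floyd_mtotally_bounded: "floyd.mtotally_bounded V"
  unfolding floyd.mtotally_bounded_def
proof (intro allI impI)
  fix e :: real assume "e > 0"
  have "\<forall>\<^sub>F D in sequentially. floyd_tail f D < e"
    using floyd_tail_tendsto_0[OF f] \<open>e > 0\<close> by (rule order_tendstoD(2))
  then obtain R where R: "floyd_tail f R < e" by (auto simp: eventually_sequentially)
  let ?K = "{x \<in> V. depth x \<le> R}"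
  have "y \<in> (\<Union>x\<in>?K. floyd.mball x e)" if y: "y \<in> V" for y
  proof (cases "depth y \<le> R")
    case True
    then show ?thesis using y \<open>e > 0\<close> by (auto intro!: bexI[of _ y])
  next
    case False
    then obtain z where z: "between v z y" "depth z = R"
      using ex_between_at_dist[OF base y, of R] by auto
    then have "fdist z y < e" using floyd_dist_le_tail_along_geodesic[OF z(1)] R by simp
    then show ?thesis using z y between_in by (auto intro!: bexI[of _ z])
  qed
  then show "\<exists>K. finite K \<and> K \<subseteq> V \<and> V \<subseteq> (\<Union>x\<in>K. floyd.mball x e)"
    using finite_graph_ball[OF locally_finite base] by (intro exI[of _ ?K]) auto
qed

lemma filterlim_depth_if_approaches:
  assumes "floyd.approaches s a" "a \<notin> floyd.membed ` V"
  shows "filterlim (\<lambda>n. depth (s n)) at_top sequentially"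
  unfolding filterlim_at_top
proof
  fix R
  have "\<forall>\<^sub>F n in sequentially. s n \<notin> {x \<in> V. depth x \<le> R}"
    using assms finite_graph_ball[OF locally_finite base]
    by (rule floyd.approaches_eventually_notin_finite)
  then show "\<forall>\<^sub>F n in sequentially. R \<le> depth (s n)"
    by (rule eventually_mono) (use floyd.approaches_in[OF assms(1)] in auto)
qed

lemma approaches_if_bounded_graph_dist:
  assumes s: "floyd.approaches s a" and a: "a \<notin> floyd.membed ` V"
    and t: "range t \<subseteq> V" "\<And>n. graph_dist E (s n) (t n) \<le> R"
  shows "floyd.approaches t a"
proof (rule floyd.approaches_if_dist_tendsto_0[OF s t(1)])
  have deep: "filterlim (\<lambda>n. depth (s n)) at_top sequentially"
    using s a by (rule filterlim_depth_if_approaches)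
  then have "\<forall>\<^sub>F n in sequentially. 2 * R \<le> depth (s n)" by (simp add: filterlim_at_top)
  then have "\<forall>\<^sub>F n in sequentially.
      0 \<le> fdist (s n) (t n) \<and> fdist (s n) (t n) \<le> floyd_tail f (depth (s n))"
    by (rule eventually_mono)
      (use floyd.approaches_in[OF s] t in \<open>blast intro: floyd.nonneg floyd_dist_le_tail_if_near\<close>)
  with deep show "(\<lambda>n. fdist (s n) (t n)) \<longlonglongrightarrow> 0"
    by (rule tendsto_0_if_le_floyd_tail[OF f])
qed

lemma geodesics_between_distinct_limits_share_vertex:
  assumes x: "floyd.approaches x a" and y: "floyd.approaches y b" and "a \<noteq> b"
  shows "\<exists>s. infinite {n. between (x n) s (y n)}"
proof -
  define e where "e = completion_dist V fdist a b"
  have "0 < e"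
    unfolding e_def
    using \<open>a \<noteq> b\<close> Metric_space.mdist_pos_eq[OF floyd.Metric_space_completion, of a b]
      floyd.approaches_in_completion[OF x] floyd.approaches_in_completion[OF y] by blast
  then obtain R where R: "\<forall>x\<in>V. \<forall>y\<in>V. e / 2 \<le> fdist x y \<longrightarrow> (\<exists>u. between x u y \<and> depth u \<le> R)"
    using karlsson_visibility[of "e / 2"] by auto
  have "\<forall>\<^sub>F n in sequentially. e / 2 < fdist (x n) (y n)"
    using floyd.approaches_dist_tendsto[OF x y]
    by (rule order_tendstoD(1)) (use \<open>0 < e\<close> in \<open>simp flip: e_def\<close>)
  then have "infinite {n \<in> UNIV. e / 2 < fdist (x n) (y n)}" (is "infinite ?I")
    by (intro infinite_eventually) auto
  moreover have "\<forall>n\<in>?I. \<exists>u\<in>{u \<in> V. depth u \<le> R}. between (x n) u (y n)"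
    using R floyd.approaches_in[OF x] floyd.approaches_in[OF y] between_in
    by (blast intro: less_imp_le)
  ultimately have "\<exists>s\<in>{u \<in> V. depth u \<le> R}. infinite {n \<in> ?I. between (x n) s (y n)}"
    by (rule pigeonhole_infinite_rel[OF _ finite_graph_ball[OF locally_finite base]])
  then obtain s where "infinite {n \<in> ?I. between (x n) s (y n)}" ..
  then have "infinite {n. between (x n) s (y n)}" by (rule infinite_super[rotated]) blast
  then show ?thesis ..
qed

lemma ex_vertex_at_dist_on_infinitely_many_geodesics:
  assumes x: "floyd.approaches x a" and a: "a \<notin> floyd.membed ` V"
    and s: "infinite {n. between (x n) s (y n)}"
  shows "\<exists>u n. infinite {n. between (x n) u (y n)} \<and>
    m \<le> n \<and> between s u (x n) \<and> graph_dist E s u = m"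
proof -
  have sV: "s \<in> V" using s between_in not_finite_existsD by blast
  define I where "I = {n \<in> {n. between (x n) s (y n)}. depth s + m \<le> depth (x n) \<and> m \<le> n}"
  have "\<forall>\<^sub>F n in sequentially. depth s + m \<le> depth (x n)"
    using filterlim_depth_if_approaches[OF x a] by (simp add: filterlim_at_top)
  then have "infinite I"
    unfolding I_def using eventually_ge_at_top
    by (intro infinite_eventually[OF s] eventually_conj)
  moreover have "\<forall>n\<in>I. \<exists>u\<in>{u \<in> V. graph_dist E s u \<le> m}. between s u (x n) \<and> graph_dist E s u = m"
  proof
    fix n assume "n \<in> I"
    then have "m \<le> graph_dist E s (x n)"
      using depth_le[OF sV floyd.approaches_in[OF x], of n] by (auto simp: I_def)
    from ex_between_at_dist[OF sV floyd.approaches_in[OF x] this]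
    show "\<exists>u\<in>{u \<in> V. graph_dist E s u \<le> m}. between s u (x n) \<and> graph_dist E s u = m"
      using between_in by blast
  qed
  ultimately have "\<exists>u\<in>{u \<in> V. graph_dist E s u \<le> m}.
      infinite {n \<in> I. between s u (x n) \<and> graph_dist E s u = m}"
    by (rule pigeonhole_infinite_rel[OF _ finite_graph_ball[OF locally_finite sV]])
  then obtain u where u: "infinite {n \<in> I. between s u (x n) \<and> graph_dist E s u = m}" ..
  have "{n \<in> I. between s u (x n) \<and> graph_dist E s u = m} \<subseteq> {n. between (x n) u (y n)}"
    by (auto simp: I_def intro: between_trans_left(1) between_commute[THEN iffD1])
  then have "infinite {n. between (x n) u (y n)}" using u infinite_super by blast
  then show ?thesis using not_finite_existsD[OF u] by (auto simp: I_def)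
qed

lemma limit_ray_of_geodesics:
  assumes x: "floyd.approaches x a" and a: "a \<notin> floyd.membed ` V"
    and s: "infinite {n. between (x n) s (y n)}"
  obtains z where "floyd.approaches z a" "\<And>m. infinite {n. between (x n) (z m) (y n)}"
proof -
  obtain z k where "\<And>m. infinite {n. between (x n) (z m) (y n)} \<and>
      m \<le> k m \<and> between s (z m) (x (k m)) \<and> graph_dist E s (z m) = m"
    using ex_vertex_at_dist_on_infinitely_many_geodesics[OF assms] by metis
  then have z: "infinite {n. between (x n) (z m) (y n)}"
    and k: "m \<le> k m" "between s (z m) (x (k m))" "graph_dist E s (z m) = m" for m
    by auto
  have "filterlim k at_top sequentially"
    by (rule filterlim_at_top_mono[OF filterlim_ident]) (simp add: k(1))
  from floyd.approaches_compose[OF x this] have "floyd.approaches z a"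
  proof (rule floyd.approaches_if_dist_tendsto_0)
    show "range z \<subseteq> V" using k(2) between_in by blast
    have "fdist (z m) (x (k m)) \<le> floyd_tail f (m - depth s)" if "depth s \<le> m" for m
      using floyd_dist_le_tail_along_geodesic[OF k(2)] k(3) that by simp
    then have "\<forall>\<^sub>F m in sequentially. 0 \<le> fdist ((x \<circ> k) m) (z m) \<and>
        fdist ((x \<circ> k) m) (z m) \<le> floyd_tail f (m - depth s)"
      unfolding eventually_sequentially by (auto simp: floyd.commute)
    then show "(\<lambda>m. fdist ((x \<circ> k) m) (z m)) \<longlonglongrightarrow> 0"
      by (rule tendsto_0_if_le_floyd_tail[OF f filterlim_minus_const_nat_at_top])
  qed
  then show thesis using z by (rule that)
qed

end


section \<open>Discontinuous and cocompact actions\<close>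

lemma (in group_action) act_one: "x \<in> E \<Longrightarrow> \<phi> \<one> x = x"
  by (simp flip: id_eq_one)

lemma (in group_action) act_inv_act: "g \<in> carrier G \<Longrightarrow> x \<in> E \<Longrightarrow> \<phi> (inv g) (\<phi> g x) = x"
  using orbit_sym_aux by blast

lemma (in group_action) act_act_inv: "g \<in> carrier G \<Longrightarrow> x \<in> E \<Longrightarrow> \<phi> g (\<phi> (inv g) x) = x"
  using act_inv_act[of "inv g" x] group_hom group.inv_inv group.inv_closed group_hom.axioms(1)
  by metis

lemma (in group_action) mult_inv_in_stabilizer:
  assumes "g \<in> carrier G" "k \<in> carrier G" "p \<in> E" "\<phi> (inv g) p = \<phi> (inv k) p"
  shows "g \<otimes> inv k \<in> stabilizer G \<phi> p"
proof -
  interpret group G using group_hom by (rule group_hom.axioms)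
  have "\<phi> (g \<otimes> inv k) p = p"
    using assms act_act_inv by (simp add: composition_rule flip: assms(4))
  then show ?thesis using assms(1,2) by (simp add: stabilizer_def)
qed

lemma acts_by_homeos_continuous_map:
  "acts_by_homeos G X \<phi> \<Longrightarrow> g \<in> carrier G \<Longrightarrow> continuous_map X X (\<phi> g)"
  unfolding acts_by_homeos_def using homeomorphic_imp_continuous_map by blast

lemma parabolic_point_iff:
  "parabolic_point G X \<phi> p \<longleftrightarrow> p \<in> topspace X \<and> infinite (stabilizer G \<phi> p) \<and>
     (\<forall>q\<in>topspace X - {p}. properly_discontinuous_at (stabilizer G \<phi> p) X \<phi> q)"
proof (cases "p \<in> topspace X \<and> infinite (stabilizer G \<phi> p)")
  case True
  let ?H = "stabilizer G \<phi> p"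
  have "{h \<in> ?H. \<phi> h ` U \<inter> U \<noteq> {}} = ?H" if "p \<in> U" for U
    using that by (force simp: stabilizer_def)
  then have "p \<in> limit_set ?H X \<phi>"
    using True by (auto simp: limit_set_def properly_discontinuous_at_def)
  then have "card (limit_set ?H X \<phi>) = 1 \<longleftrightarrow> limit_set ?H X \<phi> = {p}"
    by (auto simp: card_1_singleton_iff)
  also have "\<dots> \<longleftrightarrow> (\<forall>q\<in>topspace X - {p}. properly_discontinuous_at ?H X \<phi> q)"
    using \<open>p \<in> limit_set ?H X \<phi>\<close> by (auto simp: limit_set_def)
  finally show ?thesis using True by (simp add: parabolic_point_def)
next
  case False
  have "limit_set (stabilizer G \<phi> p) X \<phi> = {}" if "finite (stabilizer G \<phi> p)"
    using that openin_topspace by (fastforce simp: limit_set_def properly_discontinuous_at_def)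
  then show ?thesis using False by (auto simp: parabolic_point_def)
qed

lemma normal_space_closed_nhds:
  assumes "normal_space X" "closedin X A" "closedin X B" "disjnt A B"
  obtains C D where "closedin X C" "closedin X D" "A \<subseteq> X interior_of C" "B \<subseteq> X interior_of D"
    "disjnt C D"
proof -
  obtain U W where UW: "openin X U" "openin X W" "A \<subseteq> U" "B \<subseteq> W"
      "disjnt (X closure_of U) (X closure_of W)"
    using assms unfolding normal_space_disjoint_closures by meson
  then have "U \<subseteq> X interior_of (X closure_of U)" "W \<subseteq> X interior_of (X closure_of W)"
    by (simp_all add: interior_of_maximal closure_of_subset openin_subset)
  then show thesis
    using UW by (intro that[of "X closure_of U" "X closure_of W"]) auto
qed

lemma normal_space_closed_nhd_within:
  assumes X: "normal_space X" and A: "closedin X A" and U: "openin X U" "A \<subseteq> U"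
  obtains C where "closedin X C" "A \<subseteq> X interior_of C" "C \<subseteq> U"
proof -
  have "closedin X (topspace X - U)" "disjnt A (topspace X - U)" using U by (auto simp: disjnt_iff)
  from normal_space_closed_nhds[OF X A this] obtain C D
    where C: "closedin X C" "A \<subseteq> X interior_of C"
      and D: "topspace X - U \<subseteq> X interior_of D" "disjnt C D" .
  have "C \<subseteq> U"
    using C(1) D interior_of_subset[of X D] closedin_subset unfolding disjnt_iff by blast
  with C show thesis by (rule that)
qed

abbreviation inj_tuples :: "nat \<Rightarrow> 'a topology \<Rightarrow> (nat \<Rightarrow> 'a) topology" where
  "inj_tuples n X \<equiv> subtopology (product_topology (\<lambda>_. X) {..<n}) {x. inj_on x {..<n}}"

lemma quotient_map_theta: "quotient_map (inj_tuples n X) (theta n X) (\<lambda>x. x ` {..<n})"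
  unfolding theta_def by (rule quotient_map_quotient_topology)

lemma continuous_map_inj_tuples_component:
  assumes "i \<in> {..<n}"
  shows "continuous_map (inj_tuples n X) X (\<lambda>x. x i)"
  using continuous_map_product_projection[OF assms, of "\<lambda>_. X"]
  by (rule continuous_map_from_subtopology)

lemma compactin_theta:
  assumes "compact_space X" and closed: "\<And>i. i < n \<Longrightarrow> closedin X (A i)"
    and disjoint: "disjoint_family_on A {..<n}"
  shows "compactin (theta n X) ((\<lambda>x. x ` {..<n}) ` (\<Pi>\<^sub>E i\<in>{..<n}. A i))"
proof (rule image_compactin)
  have "compactin (product_topology (\<lambda>_. X) {..<n}) (\<Pi>\<^sub>E i\<in>{..<n}. A i)"
    unfolding compactin_PiE using closedin_compact_space[OF assms(1)] closed by blast
  moreover have "inj_on x {..<n}" if x: "x \<in> (\<Pi>\<^sub>E i\<in>{..<n}. A i)" for x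
  proof (rule inj_onI)
    fix i j assume ij: "i \<in> {..<n}" "j \<in> {..<n}" "x i = x j"
    then have "x i \<in> A i \<inter> A j" using PiE_mem[OF x ij(1)] PiE_mem[OF x ij(2)] by simp
    then show "i = j" using disjoint ij(1,2) unfolding disjoint_family_on_def by blast
  qed
  ultimately show "compactin (inj_tuples n X) (\<Pi>\<^sub>E i\<in>{..<n}. A i)"
    by (auto simp: compactin_subtopology)
  show "continuous_map (inj_tuples n X) (theta n X) (\<lambda>x. x ` {..<n})"
    by (rule quotient_imp_continuous_map[OF quotient_map_theta])
qed

lemma properly_discontinuous_theta_finite:
  fixes X :: "'c topology"
  assumes "properly_discontinuous G (theta n X) (\<lambda>g A. \<phi> g ` A)" "compact_space X"
    and "\<And>i. i < n \<Longrightarrow> closedin X (A i)" "disjoint_family_on A {..<n}"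
    and "\<And>i. i < n \<Longrightarrow> closedin X (B i)" "disjoint_family_on B {..<n}"
  shows "finite {g \<in> carrier G. \<forall>i<n. \<exists>a\<in>A i. \<phi> g a \<in> B i}"
proof -
  define K where "K C = (\<lambda>x. x ` {..<n}) ` (\<Pi>\<^sub>E i\<in>{..<n}. C i)" for C :: "nat \<Rightarrow> 'c set"
  have meets: "(\<lambda>A. \<phi> g ` A) ` K A \<inter> K B \<noteq> {}" if "\<forall>i<n. \<exists>a\<in>A i. \<phi> g a \<in> B i" for g
  proof -
    obtain x where x: "\<And>i. i < n \<Longrightarrow> x i \<in> A i \<and> \<phi> g (x i) \<in> B i" using \<open>\<forall>i<n. _\<close> by metis
    have "x ` {..<n} \<in> K A"
      unfolding K_def using x by (intro image_eqI[of _ _ "restrict x {..<n}"]) auto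
    moreover have "\<phi> g ` x ` {..<n} \<in> K B"
      unfolding K_def using x
      by (intro image_eqI[of _ _ "\<lambda>i\<in>{..<n}. \<phi> g (x i)"]) (auto simp: image_image)
    ultimately show ?thesis by blast
  qed
  have "finite {g \<in> carrier G. (\<lambda>A. \<phi> g ` A) ` K A \<inter> K B \<noteq> {}}"
    using assms compactin_theta unfolding K_def properly_discontinuous_def by blast
  then show ?thesis by (rule rev_finite_subset) (use meets in blast)
qed

lemma three_discontinuous_finite:
  assumes "three_discontinuous G X \<phi>" "compact_space X"
    and A: "closedin X A1" "closedin X A2" "closedin X A3"
      "disjnt A1 A2" "disjnt A1 A3" "disjnt A2 A3"
    and B: "closedin X B1" "closedin X B2" "closedin X B3"
      "disjnt B1 B2" "disjnt B1 B3" "disjnt B2 B3"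
  shows "finite {g \<in> carrier G. (\<exists>a\<in>A1. \<phi> g a \<in> B1) \<and> (\<exists>a\<in>A2. \<phi> g a \<in> B2) \<and> (\<exists>a\<in>A3. \<phi> g a \<in> B3)}"
proof -
  have closed: "closedin X ([C1, C2, C3] ! i)"
    if "closedin X C1" "closedin X C2" "closedin X C3" "i < 3" for C1 C2 C3 i
    using that by (auto simp: less_Suc_eq numeral_3_eq_3)
  have disjoint: "disjoint_family_on (\<lambda>i. [C1, C2, C3] ! i) {..<3}"
    if "disjnt C1 C2" "disjnt C1 C3" "disjnt C2 C3" for C1 C2 C3 :: "'c set"
    using that by (auto simp: disjoint_family_on_def disjnt_iff less_Suc_eq numeral_3_eq_3)
  have "finite {g \<in> carrier G. \<forall>i<3. \<exists>a\<in>[A1, A2, A3] ! i. \<phi> g a \<in> [B1, B2, B3] ! i}"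
    using assms(1,2) unfolding three_discontinuous_def
    by (rule properly_discontinuous_theta_finite)
      (fact closed[OF A(1-3)] closed[OF B(1-3)] disjoint[OF A(4-6)] disjoint[OF B(4-6)])+
  then show ?thesis by (simp add: All_less_Suc numeral_3_eq_3 conj_ac)
qed

lemma openin_theta_meets:
  assumes "openin X U"
  shows "openin (theta n X) {A \<in> topspace (theta n X). A \<inter> U \<noteq> {}}"
proof -
  let ?T = "{A \<in> topspace (theta n X). A \<inter> U \<noteq> {}}"
  have "openin (inj_tuples n X) {x \<in> topspace (inj_tuples n X). x i \<in> U}"
    if "i \<in> {..<n}" for i
    by (rule openin_continuous_map_preimage[OF continuous_map_inj_tuples_component[OF that] assms])
  then have "openin (inj_tuples n X) (\<Union>i<n. {x \<in> topspace (inj_tuples n X). x i \<in> U})" by blast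
  moreover have "(\<Union>i<n. {x \<in> topspace (inj_tuples n X). x i \<in> U}) =
      {x \<in> topspace (inj_tuples n X). x ` {..<n} \<in> ?T}"
    using quotient_imp_surjective_map[OF quotient_map_theta[where n = n and X = X]] by blast
  moreover have "?T \<subseteq> (\<lambda>x. x ` {..<n}) ` topspace (inj_tuples n X)"
    using quotient_imp_surjective_map[OF quotient_map_theta[where n = n and X = X]] by blast
  ultimately show ?thesis by (simp add: theta_def openin_quotient_topology)
qed

lemma continuous_map_theta_image:
  assumes h: "continuous_map X Y h" "inj_on h (topspace X)"
  shows "continuous_map (theta n X) (theta n Y) (image h)"
proof (rule continuous_compose_quotient_map[OF quotient_map_theta])
  let ?h = "\<lambda>x. \<lambda>i\<in>{..<n}. h (x i)"
  have "continuous_map (inj_tuples n X) Y (\<lambda>x. h (x i))" if "i \<in> {..<n}" for i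
    using continuous_map_compose[OF continuous_map_inj_tuples_component[OF that] h(1)]
    by (simp add: o_def)
  then have "continuous_map (inj_tuples n X) (product_topology (\<lambda>_. Y) {..<n}) ?h"
    by (auto simp: continuous_map_componentwise)
  moreover have "inj_on (?h x) {..<n}" if "x \<in> topspace (inj_tuples n X)" for x
    using that h(2) by (auto simp: inj_on_def PiE_iff)
  ultimately have "continuous_map (inj_tuples n X) (inj_tuples n Y) ?h"
    by (auto simp: continuous_map_in_subtopology)
  then have "continuous_map (inj_tuples n X) (theta n Y) ((\<lambda>x. x ` {..<n}) \<circ> ?h)"
    by (rule continuous_map_compose) (rule quotient_imp_continuous_map[OF quotient_map_theta])
  then show "continuous_map (inj_tuples n X) (theta n Y) (image h \<circ> (\<lambda>x. x ` {..<n}))"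
    by (rule continuous_map_eq) auto
qed

context
  fixes G (structure) and Y :: "'y topology" and \<theta> :: "'g \<Rightarrow> 'y \<Rightarrow> 'y"
  assumes group: "group G"
    and act_one: "\<And>y. y \<in> topspace Y \<Longrightarrow> \<theta> \<one> y = y"
    and act_mult: "\<And>g h y. \<lbrakk>g \<in> carrier G; h \<in> carrier G; y \<in> topspace Y\<rbrakk> \<Longrightarrow>
      \<theta> (g \<otimes> h) y = \<theta> g (\<theta> h y)"
begin

lemma orbit_in_image_saturation_iff:
  assumes y: "y \<in> topspace Y"
  shows "orbit G \<theta> y \<in> orbit G \<theta> ` {z \<in> topspace Y. \<exists>g\<in>carrier G. \<theta> g z \<in> U} \<longleftrightarrow>
    (\<exists>g\<in>carrier G. \<theta> g y \<in> U)"
proof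
  interpret group G by (rule group)
  assume "orbit G \<theta> y \<in> orbit G \<theta> ` {z \<in> topspace Y. \<exists>g\<in>carrier G. \<theta> g z \<in> U}"
  then obtain z g where z: "z \<in> topspace Y" "orbit G \<theta> y = orbit G \<theta> z"
    and g: "g \<in> carrier G" "\<theta> g z \<in> U"
    by blast
  have "\<theta> \<one> z \<in> orbit G \<theta> z" by (auto simp: orbit_def)
  then have "z \<in> orbit G \<theta> y" using z act_one by simp
  then obtain k where "k \<in> carrier G" "z = \<theta> k y" by (auto simp: orbit_def)
  then show "\<exists>g\<in>carrier G. \<theta> g y \<in> U" using g y act_mult by (intro bexI[of _ "g \<otimes> k"]) auto
qed (use y in blast)

lemma openin_quotient_image_saturation:
  assumes continuous: "\<And>g. g \<in> carrier G \<Longrightarrow> continuous_map Y Y (\<theta> g)" and U: "openin Y U"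
  shows "openin (quotient_topology Y (orbit G \<theta>))
    (orbit G \<theta> ` {y \<in> topspace Y. \<exists>g\<in>carrier G. \<theta> g y \<in> U})"
    (is "openin _ (_ ` ?sat)")
proof -
  have "?sat = (\<Union>g\<in>carrier G. {y \<in> topspace Y. \<theta> g y \<in> U})" by auto
  moreover have "openin Y (\<Union>g\<in>carrier G. {y \<in> topspace Y. \<theta> g y \<in> U})"
    using continuous openin_continuous_map_preimage[OF _ U] by blast
  moreover have "{y \<in> topspace Y. orbit G \<theta> y \<in> orbit G \<theta> ` ?sat} = ?sat"
    using orbit_in_image_saturation_iff[of _ U] by blast
  moreover have "orbit G \<theta> ` ?sat \<subseteq> orbit G \<theta> ` topspace Y" by auto
  ultimately show ?thesis by (simp add: openin_quotient_topology)
qed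

lemma compact_orbit_space_finite_translates:
  assumes continuous: "\<And>g. g \<in> carrier G \<Longrightarrow> continuous_map Y Y (\<theta> g)"
    and compact: "compact_space (quotient_topology Y (orbit G \<theta>))"
    and open_cover: "\<And>i. i \<in> I \<Longrightarrow> openin Y (U i)" "topspace Y \<subseteq> (\<Union>i\<in>I. U i)"
  obtains J where "finite J" "J \<subseteq> I"
    "\<And>y. y \<in> topspace Y \<Longrightarrow> \<exists>g\<in>carrier G. \<exists>i\<in>J. \<theta> g y \<in> U i"
proof -
  interpret group G by (rule group)
  let ?q = "orbit G \<theta>" and ?Q = "quotient_topology Y (orbit G \<theta>)"
  define sat where "sat i = {y \<in> topspace Y. \<exists>g\<in>carrier G. \<theta> g y \<in> U i}" for i
  have "openin ?Q (?q ` sat i)" if "i \<in> I" for i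
    unfolding sat_def using continuous open_cover(1)[OF that]
    by (rule openin_quotient_image_saturation)
  moreover have "topspace ?Q \<subseteq> \<Union> ((\<lambda>i. ?q ` sat i) ` I)"
  proof
    fix z assume "z \<in> topspace ?Q"
    then obtain y where y: "y \<in> topspace Y" "z = ?q y" by (auto simp: topspace_quotient_topology)
    then obtain i where "i \<in> I" "\<theta> \<one> y \<in> U i" using open_cover(2) act_one by auto
    then show "z \<in> \<Union> ((\<lambda>i. ?q ` sat i) ` I)" using y by (auto simp: sat_def)
  qed
  ultimately obtain \<F> where \<F>: "finite \<F>" "\<F> \<subseteq> (\<lambda>i. ?q ` sat i) ` I" "topspace ?Q \<subseteq> \<Union>\<F>"
    using compact unfolding compact_space_alt by (metis (no_types, lifting) imageE)
  obtain J where J: "J \<subseteq> I" "finite J" "\<F> = (\<lambda>i. ?q ` sat i) ` J"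
    using finite_subset_image[OF \<F>(1,2)] by blast
  have "\<exists>g\<in>carrier G. \<exists>i\<in>J. \<theta> g y \<in> U i" if y: "y \<in> topspace Y" for y
  proof -
    have "?q y \<in> topspace ?Q" using y by (simp add: topspace_quotient_topology)
    then obtain i where "i \<in> J" "?q y \<in> ?q ` sat i" using \<F>(3) J(3) by blast
    then show ?thesis using orbit_in_image_saturation_iff[OF y] by (auto simp: sat_def)
  qed
  then show thesis using that J by blast
qed

end

lemma two_cocompact_finite_translates:
  fixes G (structure)
  assumes act: "acts_by_homeos G X \<phi>" and cocompact: "two_cocompact G X \<phi>"
    and open_cover: "\<And>i. i \<in> I \<Longrightarrow> openin (theta 2 X) (U i)" "topspace (theta 2 X) \<subseteq> (\<Union>i\<in>I. U i)"
  obtains J where "finite J" "J \<subseteq> I"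
    "\<And>S. S \<in> topspace (theta 2 X) \<Longrightarrow> \<exists>g\<in>carrier G. \<exists>i\<in>J. \<phi> g ` S \<in> U i"
proof (rule compact_orbit_space_finite_translates[OF _ _ _ _ _ open_cover])
  interpret group_action G "topspace X" \<phi> using act by (simp add: acts_by_homeos_def)
  show "group G" using group_hom by (rule group_hom.axioms)
  show "compact_space (quotient_topology (theta 2 X) (orbit G (\<lambda>g S. \<phi> g ` S)))"
    using cocompact by (simp add: two_cocompact_def)
  show "continuous_map (theta 2 X) (theta 2 X) (image (\<phi> g))" if "g \<in> carrier G" for g
    using that inj_prop acts_by_homeos_continuous_map[OF act] by (intro continuous_map_theta_image)
  fix S assume "S \<in> topspace (theta 2 X)"
  then have "S \<subseteq> topspace X" by (simp add: topspace_theta)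
  then show "\<phi> \<one> ` S = S" "\<And>g h. \<lbrakk>g \<in> carrier G; h \<in> carrier G\<rbrakk> \<Longrightarrow> \<phi> (g \<otimes> h) ` S = \<phi> g ` \<phi> h ` S"
    using act_one composition_rule by (auto simp: image_image subset_iff intro!: image_cong)
qed (use that in blast)+

definition straddling_pairs :: "'a topology \<Rightarrow> 'a set \<Rightarrow> 'a set \<Rightarrow> 'a set set" where
  "straddling_pairs X A B =
     {S \<in> topspace (theta 2 X). S \<inter> X interior_of A \<noteq> {} \<and> S \<inter> X interior_of B \<noteq> {}}"

lemma openin_straddling_pairs: "openin (theta 2 X) (straddling_pairs X A B)"
proof -
  have "straddling_pairs X A B = {S \<in> topspace (theta 2 X). S \<inter> X interior_of A \<noteq> {}} \<inter>
      {S \<in> topspace (theta 2 X). S \<inter> X interior_of B \<noteq> {}}"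
    by (auto simp: straddling_pairs_def)
  then show ?thesis by (simp add: openin_Int openin_theta_meets)
qed

lemma straddling_pairs_cases:
  assumes "{x, y} \<in> straddling_pairs X A B" "disjnt A B"
  shows "x \<in> A \<and> y \<in> B \<or> x \<in> B \<and> y \<in> A"
  using assms interior_of_subset[of X A] interior_of_subset[of X B]
  by (fastforce simp: straddling_pairs_def disjnt_iff)

lemma ex_straddling_pairs:
  assumes X: "compact_space X" "Hausdorff_space X" and S: "S \<in> topspace (theta 2 X)"
  obtains A B where "closedin X A" "closedin X B" "disjnt A B" "S \<in> straddling_pairs X A B"
proof -
  obtain x y where xy: "x \<in> topspace X" "y \<in> topspace X" "x \<noteq> y" "S = {x, y}"
    using S by (auto simp: topspace_theta card_2_iff)
  then have "closedin X {x}" "closedin X {y}" "disjnt {x} {y}"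
    using X(2) by (auto simp: closedin_Hausdorff_singleton)
  then obtain A B where "closedin X A" "closedin X B" "{x} \<subseteq> X interior_of A"
    "{y} \<subseteq> X interior_of B" "disjnt A B"
    using normal_space_closed_nhds compact_Hausdorff_or_regular_imp_normal_space X by metis
  then show thesis using that S xy(4) by (auto simp: straddling_pairs_def)
qed

lemma two_cocompact_separation:
  fixes G (structure)
  assumes act: "acts_by_homeos G X \<phi>" "two_cocompact G X \<phi>"
    and X: "compact_space X" "Hausdorff_space X"
  obtains P where "finite P" "\<And>A B. (A, B) \<in> P \<Longrightarrow> closedin X A \<and> closedin X B \<and> disjnt A B"
    "\<And>x y. \<lbrakk>x \<in> topspace X; y \<in> topspace X; x \<noteq> y\<rbrakk> \<Longrightarrow>
       \<exists>g\<in>carrier G. \<exists>A B. (A, B) \<in> P \<and> \<phi> g x \<in> A \<and> \<phi> g y \<in> B"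
proof -
  define I where "I = {(A, B). closedin X A \<and> closedin X B \<and> disjnt A B}"
  let ?U = "\<lambda>(A, B). straddling_pairs X A B"
  have "openin (theta 2 X) (?U i)" for i by (cases i) (simp add: openin_straddling_pairs)
  moreover have "topspace (theta 2 X) \<subseteq> (\<Union>i\<in>I. ?U i)"
  proof
    fix S assume "S \<in> topspace (theta 2 X)"
    with X obtain A B where "closedin X A" "closedin X B" "disjnt A B" "S \<in> straddling_pairs X A B"
      by (rule ex_straddling_pairs)
    then show "S \<in> (\<Union>i\<in>I. ?U i)" by (auto simp: I_def)
  qed
  ultimately obtain J where J: "finite J" "J \<subseteq> I"
    "\<And>S. S \<in> topspace (theta 2 X) \<Longrightarrow> \<exists>g\<in>carrier G. \<exists>i\<in>J. \<phi> g ` S \<in> ?U i"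
    using two_cocompact_finite_translates[OF act] by metis
  show thesis
  proof (rule that)
    show "finite (J \<union> prod.swap ` J)" using J(1) by simp
    show "closedin X A \<and> closedin X B \<and> disjnt A B" if "(A, B) \<in> J \<union> prod.swap ` J" for A B
      using that J(2) by (auto simp: I_def disjnt_sym)
    fix x y assume "x \<in> topspace X" "y \<in> topspace X" "x \<noteq> y"
    then have "{x, y} \<in> topspace (theta 2 X)" by (simp add: topspace_theta)
    then obtain g A B where g: "g \<in> carrier G" "(A, B) \<in> J"
        "{\<phi> g x, \<phi> g y} \<in> straddling_pairs X A B"
      using J(3) by fastforce
    then have "\<phi> g x \<in> A \<and> \<phi> g y \<in> B \<or> \<phi> g x \<in> B \<and> \<phi> g y \<in> A"
      using J(2) by (intro straddling_pairs_cases) (auto simp: I_def)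
    then show "\<exists>g\<in>carrier G. \<exists>A B. (A, B) \<in> J \<union> prod.swap ` J \<and> \<phi> g x \<in> A \<and> \<phi> g y \<in> B"
      using g(1,2) by force
  qed
qed


section \<open>Cayley graphs\<close>

locale cayley = group G for G (structure) +
  fixes S :: "'a set"
  assumes finite_generators: "finite S" and generators_in: "S \<subseteq> carrier G"
    and generates: "generate G S = carrier G"
begin

lemma simple_graph_cayley: "simple_graph (carrier G) (cayley_edges G S)"
  using generators_in by (auto simp: simple_graph_def cayley_edges_def)

lemma ex_graph_path_mult_generator:
  assumes "x \<in> carrier G" "s \<in> S"
  shows "\<exists>xs. graph_path (cayley_edges G S) x xs (x \<otimes> s)"
proof (cases "x \<otimes> s = x")
  case True
  then show ?thesis by (intro exI[of _ "[x]"]) (simp add: graph_path_def)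
next
  case False
  then have "{x, x \<otimes> s} \<in> cayley_edges G S" using assms by (auto simp: cayley_edges_def)
  then show ?thesis by (intro exI[of _ "[x, x \<otimes> s]"]) (simp add: graph_path_def)
qed

lemma ex_graph_path_mult:
  assumes "g \<in> generate G S" "x \<in> carrier G"
  shows "\<exists>xs. graph_path (cayley_edges G S) x xs (x \<otimes> g)"
  using assms
proof (induction arbitrary: x rule: generate.induct)
  case one
  then show ?case by (intro exI[of _ "[x]"]) (simp add: graph_path_def)
next
  case (incl s)
  then show ?case by (intro ex_graph_path_mult_generator)
next
  case (inv s)
  then have s: "s \<in> carrier G" using generators_in by blast
  then have "x \<otimes> inv s \<otimes> s = x" "x \<otimes> inv s \<in> carrier G"
    using inv.prems by (simp_all add: m_assoc)
  then show ?case using ex_graph_path_mult_generator inv.hyps graph_path_rev by metis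
next
  case (eng g h)
  then have gh: "g \<in> carrier G" "h \<in> carrier G" using generates by auto
  obtain xs where "graph_path (cayley_edges G S) x xs (x \<otimes> g)" using eng.IH(1) eng.prems by blast
  moreover obtain ys where "graph_path (cayley_edges G S) (x \<otimes> g) ys (x \<otimes> g \<otimes> h)"
    using eng.IH(2) eng.prems gh(1) by blast
  moreover have "x \<otimes> g \<otimes> h = x \<otimes> (g \<otimes> h)" using eng.prems gh by (rule m_assoc)
  ultimately show ?case using graph_path_append by metis
qed

lemma connected_graph_cayley: "connected_graph (carrier G) (cayley_edges G S)"
  unfolding connected_graph_def
proof (intro ballI)
  fix x y assume xy: "x \<in> carrier G" "y \<in> carrier G"
  then have "inv x \<otimes> y \<in> generate G S" using generates by simp
  from ex_graph_path_mult[OF this xy(1)] show "\<exists>xs. graph_path (cayley_edges G S) x xs y"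
    using xy by (simp flip: m_assoc)
qed

lemma locally_finite_graph_cayley: "locally_finite_graph (carrier G) (cayley_edges G S)"
  unfolding locally_finite_graph_def
proof
  fix v assume v: "v \<in> carrier G"
  have "{e \<in> cayley_edges G S. v \<in> e} \<subseteq> (\<lambda>s. {v, v \<otimes> s}) ` S \<union> (\<lambda>s. {v \<otimes> inv s, v}) ` S"
  proof
    fix e assume "e \<in> {e \<in> cayley_edges G S. v \<in> e}"
    then obtain g s where gs: "e = {g, g \<otimes> s}" "g \<in> carrier G" "s \<in> S" "v = g \<or> v = g \<otimes> s"
      by (auto simp: cayley_edges_def)
    have "g = v \<otimes> inv s" if "v = g \<otimes> s" using that gs generators_in by (auto simp: m_assoc)
    then show "e \<in> (\<lambda>s. {v, v \<otimes> s}) ` S \<union> (\<lambda>s. {v \<otimes> inv s, v}) ` S" using gs by auto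
  qed
  then show "finite {e \<in> cayley_edges G S. v \<in> e}"
    by (rule finite_subset) (simp add: finite_generators)
qed

sublocale connected_simple_graph "carrier G" "cayley_edges G S"
  by unfold_locales (fact simple_graph_cayley connected_graph_cayley)+

lemma cayley_edge_left_mult:
  assumes "{x, y} \<in> cayley_edges G S" "k \<in> carrier G"
  shows "{k \<otimes> x, k \<otimes> y} \<in> cayley_edges G S"
proof -
  obtain g s where gs: "{x, y} = {g, g \<otimes> s}" "g \<in> carrier G" "s \<in> S" "g \<otimes> s \<noteq> g"
    using assms(1) by (auto simp: cayley_edges_def)
  have s: "s \<in> carrier G" using gs(3) generators_in by blast
  have "{k \<otimes> x, k \<otimes> y} = (\<lambda>z. k \<otimes> z) ` {x, y}" by simp
  also have "\<dots> = {k \<otimes> g, k \<otimes> g \<otimes> s}" using gs(1,2) s assms(2) by (simp add: m_assoc)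
  finally show ?thesis
    using gs s assms(2) unfolding cayley_edges_def
    by (intro CollectI exI[of _ "k \<otimes> g"] exI[of _ s]) (simp add: m_assoc)
qed

lemma graph_path_left_mult:
  assumes "graph_path (cayley_edges G S) x xs y" "k \<in> carrier G"
  shows "graph_path (cayley_edges G S) (k \<otimes> x) (map (\<lambda>z. k \<otimes> z) xs) (k \<otimes> y)"
  using assms cayley_edge_left_mult unfolding graph_path_def
  by (auto simp: hd_map last_map successively_map intro: successively_mono)

lemma graph_dist_left_mult:
  assumes "k \<in> carrier G" "x \<in> carrier G" "y \<in> carrier G"
  shows "graph_dist (cayley_edges G S) (k \<otimes> x) (k \<otimes> y) = graph_dist (cayley_edges G S) x y"
proof -
  have le: "graph_dist (cayley_edges G S) (k \<otimes> x) (k \<otimes> y) \<le> graph_dist (cayley_edges G S) x y"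
    if k: "k \<in> carrier G" and xy: "x \<in> carrier G" "y \<in> carrier G" for k x y
  proof -
    obtain xs where "graph_path (cayley_edges G S) x xs y"
      "length xs = Suc (graph_dist (cayley_edges G S) x y)"
      using ex_shortest_graph_path[OF connected xy] by blast
    then show ?thesis using graph_dist_le[OF graph_path_left_mult[OF _ k]] by fastforce
  qed
  show ?thesis
    using le[OF assms] le[of "inv k" "k \<otimes> x" "k \<otimes> y"] assms by (simp flip: m_assoc)
qed

lemma between_left_mult: "k \<in> carrier G \<Longrightarrow> between x u y \<Longrightarrow> between (k \<otimes> x) (k \<otimes> u) (k \<otimes> y)"
  by (simp add: between_def graph_dist_left_mult)

lemma floyd_graph_cayley: "floyd_function f \<Longrightarrow> floyd_graph (carrier G) (cayley_edges G S) \<one> f"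
  using locally_finite_graph_cayley by unfold_locales simp_all

end


section \<open>Orbit maps that extend to the Floyd completion\<close>

locale floyd_orbit_map = cayley G S for G (structure) and S +
  fixes f :: "nat \<Rightarrow> real" and M :: "'m topology" and \<alpha> :: "'a \<Rightarrow> 'm \<Rightarrow> 'm" and b :: 'm
    and \<Phi> :: "(nat \<Rightarrow> 'a) set \<Rightarrow> 'm"
  assumes floyd_function: "floyd_function f"
    and compact_M: "compact_space M" and Hausdorff_M: "Hausdorff_space M"
    and homeos_M: "acts_by_homeos G M \<alpha>" and three_discontinuous_M: "three_discontinuous G M \<alpha>"
    and isolated_base: "openin M {b}" and finite_stabilizer_base: "finite (stabilizer G \<alpha> b)"
    and continuous_extension: "continuous_map (floyd_completion G S f) M \<Phi>"
    and extension_embed: "g \<in> carrier G \<Longrightarrow> \<Phi> (floyd_embed G S f g) = \<alpha> g b"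
begin

abbreviation orb :: "'a \<Rightarrow> 'm" where
  "orb g \<equiv> \<alpha> g b"

sublocale M: group_action G "topspace M" \<alpha>
  using homeos_M by (simp add: acts_by_homeos_def)

sublocale floyd_graph "carrier G" "cayley_edges G S" \<one> f
  by (rule floyd_graph_cayley[OF floyd_function])

lemma floyd_completion_eq: "floyd_completion G S f = floyd.mcompletion"
  by (simp add: floyd_completion_def group_floyd_dist_def)

lemma floyd_embed_eq: "floyd_embed G S f = floyd.membed"
  by (simp add: floyd_embed_def group_floyd_dist_def)

lemma floyd_boundary_iff:
  "a \<in> floyd_boundary G S f \<longleftrightarrow>
     a \<in> cauchy_completion (carrier G) fdist \<and> a \<notin> floyd.membed ` carrier G"
  by (simp add: floyd_boundary_def floyd_completion_eq floyd_embed_eq floyd.topspace_mcompletion)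

lemma base_in: "b \<in> topspace M"
  using openin_subset[OF isolated_base] by simp

lemma orb_in: "g \<in> carrier G \<Longrightarrow> orb g \<in> topspace M"
  using M.element_image base_in by blast

lemma orb_one: "orb \<one> = b"
  by (rule M.act_one[OF base_in])

lemma act_orb: "g \<in> carrier G \<Longrightarrow> h \<in> carrier G \<Longrightarrow> \<alpha> g (orb h) = orb (g \<otimes> h)"
  by (simp add: M.composition_rule base_in)

lemma normal_M: "normal_space M"
  using compact_Hausdorff_or_regular_imp_normal_space compact_M Hausdorff_M by blast

lemma closedin_point: "x \<in> topspace M \<Longrightarrow> closedin M {x}"
  using Hausdorff_M by (rule closedin_Hausdorff_singleton)

lemma openin_orb:
  assumes "g \<in> carrier G"
  shows "openin M {orb g}"
proof -
  have "open_map M M (\<alpha> g)"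
    using homeos_M assms homeomorphic_imp_open_map by (auto simp: acts_by_homeos_def)
  then have "openin M (\<alpha> g ` {b})" using isolated_base unfolding open_map_def by blast
  then show ?thesis by simp
qed

lemma openin_act_preimage:
  "g \<in> carrier G \<Longrightarrow> openin M U \<Longrightarrow> openin M {x \<in> topspace M. \<alpha> g x \<in> U}"
  by (rule openin_continuous_map_preimage[OF acts_by_homeos_continuous_map[OF homeos_M]])

lemma closed_nhds_avoiding_orb:
  assumes "p \<in> topspace M" "q \<in> topspace M" "p \<noteq> q"
    and s: "s \<in> carrier G" "p \<noteq> orb s" "q \<noteq> orb s"
  obtains C D where "closedin M C" "closedin M D" "p \<in> M interior_of C" "q \<in> M interior_of D"
    "disjnt C D" "orb s \<notin> C" "orb s \<notin> D"
proof -
  let ?O = "topspace M - {orb s}"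
  have "closedin M ?O" "openin M ?O"
    using openin_orb[OF s(1)] closedin_point[OF orb_in[OF s(1)]] by auto
  then have interior: "M interior_of (C \<inter> ?O) = M interior_of C \<inter> ?O" for C
    by (simp add: interior_of_Int interior_of_openin)
  have "disjnt {p} {q}" using assms(3) by simp
  from normal_space_closed_nhds[OF normal_M closedin_point closedin_point this] assms(1,2)
  obtain C D where "closedin M C" "closedin M D" "{p} \<subseteq> M interior_of C"
    "{q} \<subseteq> M interior_of D" "disjnt C D"
    by blast
  then show thesis
    using \<open>closedin M ?O\<close> assms
    by (intro that[of "C \<inter> ?O" "D \<inter> ?O"]) (auto simp: interior disjnt_iff closedin_Int)
qed

lemma approaches_limitin_orb:
  assumes "floyd.approaches s a"
  shows "limitin M (\<lambda>n. orb (s n)) (\<Phi> a) sequentially"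
proof -
  have "\<Phi> (floyd.membed (s n)) = orb (s n)" for n
    using extension_embed floyd.approaches_in[OF assms] by (simp add: floyd_embed_eq)
  moreover have "continuous_map floyd.mcompletion M \<Phi>"
    using continuous_extension by (simp add: floyd_completion_eq)
  from floyd.continuous_map_limitin_if_approaches[OF this assms]
  have "limitin M (\<lambda>n. \<Phi> (floyd.membed (s n))) (\<Phi> a) sequentially" .
  ultimately show ?thesis by simp
qed

lemma finite_range_outside_if_approaches:
  assumes "floyd.approaches s a" "openin M U" "\<Phi> a \<in> U"
  shows "finite {h \<in> range s. orb h \<notin> U}"
proof -
  have "\<forall>\<^sub>F n in sequentially. orb (s n) \<in> U"
    using approaches_limitin_orb[OF assms(1)] assms(2,3) by (simp add: limitin_def)
  then obtain N where "\<And>n. N \<le> n \<Longrightarrow> orb (s n) \<in> U" by (auto simp: eventually_sequentially)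
  then have "{h \<in> range s. orb h \<notin> U} \<subseteq> s ` {..<N}" using not_le_imp_less by auto
  then show ?thesis by (rule finite_subset) simp
qed

lemma approaches_in_closed:
  assumes "floyd.approaches s a" "closedin M A" "\<And>n. orb (s n) \<in> A"
  shows "\<Phi> a \<in> A"
  using approaches_limitin_orb[OF assms(1)] assms(2)
  by (rule limitin_closedin) (use assms(3) in auto)

lemma extension_boundary_not_orb:
  assumes a: "a \<in> floyd_boundary G S f" and g: "g \<in> carrier G"
  shows "\<Phi> a \<noteq> orb g"
proof
  assume eq: "\<Phi> a = orb g"
  obtain s where s: "floyd.approaches s a"
    using floyd.ex_approaches a by (auto simp: floyd_boundary_iff)
  let ?fibre = "{h \<in> carrier G. orb h = orb g}"
  have "?fibre \<subseteq> (\<lambda>k. g \<otimes> k) ` stabilizer G \<alpha> b"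
  proof
    fix h assume "h \<in> ?fibre"
    then have h: "h \<in> carrier G" "orb h = orb g" by auto
    then have "orb (inv g \<otimes> h) = b" using g act_orb[of "inv g"] orb_one by (metis inv_closed l_inv)
    then have "inv g \<otimes> h \<in> stabilizer G \<alpha> b" using g h by (simp add: stabilizer_def)
    moreover have "h = g \<otimes> (inv g \<otimes> h)" using g h by (simp flip: m_assoc)
    ultimately show "h \<in> (\<lambda>k. g \<otimes> k) ` stabilizer G \<alpha> b" by blast
  qed
  then have "finite ?fibre" using finite_stabilizer_base finite_surj by blast
  moreover have "a \<notin> floyd.membed ` carrier G" using a by (simp add: floyd_boundary_iff)
  ultimately have "\<forall>\<^sub>F n in sequentially. s n \<notin> ?fibre"
    using floyd.approaches_eventually_notin_finite[OF s] by blast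
  moreover have "\<forall>\<^sub>F n in sequentially. orb (s n) \<in> {orb g}"
    using approaches_limitin_orb[OF s] openin_orb[OF g] eq unfolding limitin_def by auto
  ultimately have "\<forall>\<^sub>F n in sequentially. False"
    by eventually_elim (use floyd.approaches_in[OF s] in auto)
  then show False by simp
qed

lemma floyd_dist_bounded_below:
  assumes AC: "closedin M A" "closedin M C" "disjnt A C"
  shows "\<exists>e>0. \<forall>x\<in>carrier G. \<forall>y\<in>carrier G. orb x \<in> A \<longrightarrow> orb y \<in> C \<longrightarrow> e \<le> fdist x y"
proof (rule ccontr)
  assume "\<not> ?thesis"
  then have "\<exists>x\<in>carrier G. \<exists>y\<in>carrier G.
      orb x \<in> A \<and> orb y \<in> C \<and> fdist x y < inverse (real (Suc n))" for n
    by (metis inverse_positive_iff_positive linorder_not_le of_nat_0_less_iff zero_less_Suc)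
  then obtain x y where x: "\<And>n. x n \<in> carrier G" "\<And>n. orb (x n) \<in> A"
    and y: "\<And>n. y n \<in> carrier G" "\<And>n. orb (y n) \<in> C"
    and xy: "\<And>n. fdist (x n) (y n) < inverse (real (Suc n))" by metis
  obtain r a where r: "strict_mono r" "floyd.approaches (x \<circ> r) a"
    using floyd.mtotally_bounded_approaches[OF floyd_mtotally_bounded] x(1) by blast
  have "(\<lambda>n. fdist (x n) (y n)) \<longlonglongrightarrow> 0"
    using xy by (intro Lim_null_comparison[OF always_eventually LIMSEQ_inverse_real_of_nat])
      (simp add: less_imp_le)
  then have "(\<lambda>n. fdist ((x \<circ> r) n) ((y \<circ> r) n)) \<longlonglongrightarrow> 0"
    using LIMSEQ_subseq_LIMSEQ[OF _ r(1)] by (fastforce simp: o_def)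
  then have "floyd.approaches (y \<circ> r) a"
    using y(1) by (intro floyd.approaches_if_dist_tendsto_0[OF r(2)]) auto
  then have "\<Phi> a \<in> C" using approaches_in_closed[OF _ AC(2)] y(2) by simp
  moreover have "\<Phi> a \<in> A" using approaches_in_closed[OF r(2) AC(1)] x(2) by simp
  ultimately show False using AC(3) by (auto simp: disjnt_iff)
qed

text \<open>A geodesic with both ends in \<open>A\<close> that visits \<open>C\<close> at \<open>g\<close> passes near the identity both before
  and after \<open>g\<close>, and it has bounded length between these two visits.\<close>

lemma finite_between:
  assumes AC: "closedin M A" "closedin M C" "disjnt A C"
  shows "finite {g \<in> carrier G. orb g \<in> C \<and> (\<exists>x y. between x g y \<and> orb x \<in> A \<and> orb y \<in> A)}"
proof -
  obtain e where e: "e > 0"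
    "\<forall>x\<in>carrier G. \<forall>y\<in>carrier G. orb x \<in> A \<longrightarrow> orb y \<in> C \<longrightarrow> e \<le> fdist x y"
    using floyd_dist_bounded_below[OF AC] by blast
  obtain R where R: "\<forall>x\<in>carrier G. \<forall>y\<in>carrier G. e \<le> fdist x y \<longrightarrow> (\<exists>u. between x u y \<and> depth u \<le> R)"
    using karlsson_visibility[OF e(1)] by blast
  have "depth g \<le> 3 * R" if g: "orb g \<in> C" "between x g y" "orb x \<in> A" "orb y \<in> A" for g x y
  proof -
    have G: "x \<in> carrier G" "g \<in> carrier G" "y \<in> carrier G" using between_in[OF g(2)] by auto
    obtain s where "between x s g" "depth s \<le> R" using R e(2) G g by blast
    moreover obtain t where "between g t y" "depth t \<le> R"
      using R e(2) G g between_commute by metis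
    ultimately show ?thesis using depth_le_if_between_both_ways[OF g(2)] by blast
  qed
  then show ?thesis
    by (intro finite_subset[OF _ finite_graph_ball[OF locally_finite base, of "3 * R"]]) blast
qed

text \<open>The existence of a bi-infinite geodesic through \<open>g\<close> with both ends at \<open>q\<close>, in terms of finite
  geodesics.\<close>

definition horocyclic :: "'m \<Rightarrow> 'a \<Rightarrow> bool" where
  "horocyclic q g \<longleftrightarrow> (\<forall>U. openin M U \<and> q \<in> U \<longrightarrow> (\<exists>x y. between x g y \<and> orb x \<in> U \<and> orb y \<in> U))"

lemma horocyclic_left_mult:
  assumes k: "k \<in> carrier G" and q: "q \<in> topspace M" and g: "horocyclic q g"
  shows "horocyclic (\<alpha> k q) (k \<otimes> g)"
  unfolding horocyclic_def
proof (intro allI impI)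
  fix U assume "openin M U \<and> \<alpha> k q \<in> U"
  then have "openin M {x \<in> topspace M. \<alpha> k x \<in> U}" "q \<in> {x \<in> topspace M. \<alpha> k x \<in> U}"
    using openin_act_preimage[OF k] q by auto
  then obtain x y where xy: "between x g y" "\<alpha> k (orb x) \<in> U" "\<alpha> k (orb y) \<in> U"
    using g unfolding horocyclic_def by blast
  then have "between (k \<otimes> x) (k \<otimes> g) (k \<otimes> y)" "orb (k \<otimes> x) \<in> U" "orb (k \<otimes> y) \<in> U"
    using k between_in[OF xy(1)] by (auto simp: between_left_mult act_orb)
  then show "\<exists>x y. between x (k \<otimes> g) y \<and> orb x \<in> U \<and> orb y \<in> U" by blast
qed

lemma closedin_horocyclic: "closedin M {q \<in> topspace M. horocyclic q g}"
proof -
  have "M closure_of {q \<in> topspace M. horocyclic q g} \<subseteq> {q \<in> topspace M. horocyclic q g}"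
    unfolding horocyclic_def closure_of_def by blast
  then show ?thesis by (auto simp flip: closure_of_subset_eq)
qed

lemma finite_horocyclic_outside:
  assumes "closedin M A" "openin M U" "A \<subseteq> U"
  shows "finite {g \<in> carrier G. orb g \<notin> U \<and> (\<exists>q\<in>A. horocyclic q g)}"
proof -
  obtain C where C: "closedin M C" "A \<subseteq> M interior_of C" "C \<subseteq> U"
    using normal_space_closed_nhd_within[OF normal_M assms] .
  have near: "\<exists>x y. between x g y \<and> orb x \<in> C \<and> orb y \<in> C" if q: "q \<in> A" "horocyclic q g" for q g
  proof -
    have "openin M (M interior_of C)" "q \<in> M interior_of C" using C(2) q(1) by auto
    then obtain x y where "between x g y" "orb x \<in> M interior_of C" "orb y \<in> M interior_of C"
      using q(2) unfolding horocyclic_def by blast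
    then show ?thesis using interior_of_subset[of M C] by blast
  qed
  have "finite {g \<in> carrier G. orb g \<in> topspace M - U \<and>
      (\<exists>x y. between x g y \<and> orb x \<in> C \<and> orb y \<in> C)}"
    using C(1,3) assms(2) by (intro finite_between) (auto simp: disjnt_iff)
  then show ?thesis by (rule rev_finite_subset) (use near in \<open>auto simp: orb_in\<close>)
qed

lemma finite_horocyclic_for_both:
  assumes "closedin M A" "closedin M B" "disjnt A B"
  shows "finite {g \<in> carrier G. (\<exists>q\<in>A. horocyclic q g) \<and> (\<exists>q\<in>B. horocyclic q g)}"
proof -
  obtain C D where CD: "A \<subseteq> M interior_of C" "B \<subseteq> M interior_of D" "disjnt C D"
    using normal_space_closed_nhds[OF normal_M assms] by metis
  then have "orb g \<notin> M interior_of C \<or> orb g \<notin> M interior_of D" for g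
    using interior_of_subset by (force simp: disjnt_iff)
  then have "{g \<in> carrier G. (\<exists>q\<in>A. horocyclic q g) \<and> (\<exists>q\<in>B. horocyclic q g)} \<subseteq>
      {g \<in> carrier G. orb g \<notin> M interior_of C \<and> (\<exists>q\<in>A. horocyclic q g)} \<union>
      {g \<in> carrier G. orb g \<notin> M interior_of D \<and> (\<exists>q\<in>B. horocyclic q g)}"
    by blast
  then show ?thesis
    by (rule finite_subset) (use assms CD in \<open>simp add: finite_horocyclic_outside\<close>)
qed

lemma finite_stabilizer_orb_outside:
  assumes p: "p \<in> topspace M" and s: "s \<in> carrier G" "horocyclic p s"
    and U: "openin M U" "p \<in> U"
  shows "finite {h \<in> stabilizer G \<alpha> p. orb (h \<otimes> s) \<notin> U}" (is "finite ?H")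
proof (rule finite_imageD)
  have "(\<lambda>h. h \<otimes> s) ` ?H \<subseteq> {g \<in> carrier G. orb g \<notin> U \<and> (\<exists>q\<in>{p}. horocyclic q g)}"
    using s horocyclic_left_mult[OF _ p s(2)] by (force simp: stabilizer_def)
  then show "finite ((\<lambda>h. h \<otimes> s) ` ?H)"
    by (rule finite_subset) (use closedin_point[OF p] U in \<open>intro finite_horocyclic_outside; simp\<close>)
  show "inj_on (\<lambda>h. h \<otimes> s) ?H" using s(1) by (auto simp: inj_on_def stabilizer_def)
qed

text \<open>Infinitely many \<open>h\<close> that nearly fix \<open>q\<close> would move the triples \<open>(q, h\<^sup>-\<^sup>1 w, w)\<close>, where
  \<open>w = orb s\<close>, to the triples \<open>(h q, w, h w)\<close>, although both \<open>h\<^sup>-\<^sup>1 w\<close> and \<open>h w\<close> are close to \<open>p\<close>.\<close>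

lemma stabilizer_properly_discontinuous_at:
  assumes p: "p \<in> topspace M" "p \<noteq> orb s" and s: "s \<in> carrier G" "horocyclic p s"
    and q: "q \<in> topspace M" "q \<noteq> p" "q \<noteq> orb s"
  shows "properly_discontinuous_at (stabilizer G \<alpha> p) M \<alpha> q"
proof -
  let ?H = "stabilizer G \<alpha> p"
  obtain C D where CD: "closedin M C" "closedin M D" "p \<in> M interior_of C" "q \<in> M interior_of D"
      "disjnt C D" "orb s \<notin> C" "orb s \<notin> D"
    using closed_nhds_avoiding_orb[of p q s] p q s(1) by blast
  define T where "T = {g \<in> carrier G.
    (\<exists>x\<in>D. \<alpha> g x \<in> D) \<and> (\<exists>x\<in>C. \<alpha> g x \<in> {orb s}) \<and> (\<exists>x\<in>{orb s}. \<alpha> g x \<in> C)}"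
  have "finite T"
    unfolding T_def using CD closedin_point[OF orb_in[OF s(1)]]
    by (intro three_discontinuous_finite[OF three_discontinuous_M compact_M])
      (auto simp: disjnt_iff)
  moreover define B where "B = {h \<in> ?H. orb (h \<otimes> s) \<notin> M interior_of C}"
  have "finite B"
    unfolding B_def using finite_stabilizer_orb_outside[OF p(1) s] CD(3) by simp
  moreover have "{h \<in> ?H. \<alpha> h ` (M interior_of D) \<inter> M interior_of D \<noteq> {}} \<subseteq> T \<union> B \<union> (\<lambda>h. inv h) ` B"
  proof
    fix h assume h: "h \<in> {h \<in> ?H. \<alpha> h ` (M interior_of D) \<inter> M interior_of D \<noteq> {}}"
    then have hG: "h \<in> carrier G" and inv_h: "inv h \<in> ?H" "h = inv (inv h)"
      using M.stabilizer_m_inv_closed[OF p(1)] by (auto simp: stabilizer_def)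
    have "h \<in> T" if "h \<notin> B" "inv h \<notin> B"
    proof -
      have "\<exists>x\<in>D. \<alpha> h x \<in> D" using h interior_of_subset[of M D] by blast
      moreover have "orb (inv h \<otimes> s) \<in> C" "orb (h \<otimes> s) \<in> C"
        using that h inv_h(1) interior_of_subset[of M C] by (auto simp: B_def)
      moreover have "\<alpha> h (orb (inv h \<otimes> s)) = orb s" "\<alpha> h (orb s) = orb (h \<otimes> s)"
        using hG s(1) by (simp_all add: act_orb flip: m_assoc)
      ultimately show ?thesis using hG unfolding T_def by auto
    qed
    then show "h \<in> T \<union> B \<union> (\<lambda>h. inv h) ` B" using inv_h(2) by blast
  qed
  ultimately have "finite {h \<in> ?H. \<alpha> h ` (M interior_of D) \<inter> M interior_of D \<noteq> {}}"
    by (meson finite_UnI finite_imageI finite_subset)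
  then show ?thesis unfolding properly_discontinuous_at_def using CD(4) openin_interior_of by blast
qed

text \<open>The point \<open>y = h\<^sup>-\<^sup>1 b\<close> is far from \<open>p\<close> or from \<open>x\<close>. If it is far from \<open>p\<close>, then \<open>h\<close> moves the
  triple \<open>(b, p, y)\<close> to a triple close to \<open>(x, p, b)\<close>; if it is far from \<open>x\<close>, then \<open>h\<close> moves
  \<open>(b, x, y)\<close> to such a triple.\<close>

lemma finite_fixing_pulled_apart:
  assumes CD: "closedin M C" "closedin M D" "disjnt C D" "b \<notin> C" "b \<notin> D"
    and p: "p \<in> M interior_of C" and x: "x \<in> M interior_of D"
  shows "finite {h \<in> stabilizer G \<alpha> p. orb h \<in> D \<and> \<alpha> h x \<in> C}"
proof -
  have pC: "p \<in> C" and xD: "x \<in> D"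
    using p x interior_of_subset[of M C] interior_of_subset[of M D] by auto
  then have closed: "closedin M {b}" "closedin M {p}" "closedin M {x}"
    using base_in closedin_subset[OF CD(1)] closedin_subset[OF CD(2)] closedin_point by auto
  define far where "far C = topspace M - {b} - M interior_of C" for C
  have closed_far: "closedin M (far C)" for C
    unfolding far_def by (intro closedin_diff closedin_topspace isolated_base openin_interior_of)
  define T1 where "T1 = {g \<in> carrier G.
    (\<exists>a\<in>{b}. \<alpha> g a \<in> D) \<and> (\<exists>a\<in>{p}. \<alpha> g a \<in> {p}) \<and> (\<exists>a\<in>far C. \<alpha> g a \<in> {b})}"
  define T2 where "T2 = {g \<in> carrier G.
    (\<exists>a\<in>{b}. \<alpha> g a \<in> D) \<and> (\<exists>a\<in>{x}. \<alpha> g a \<in> C) \<and> (\<exists>a\<in>far D. \<alpha> g a \<in> {b})}"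
  have "finite T1"
    unfolding T1_def using CD p pC closed closed_far
    by (intro three_discontinuous_finite[OF three_discontinuous_M compact_M])
      (auto simp: disjnt_iff far_def)
  moreover have "finite T2"
    unfolding T2_def using CD x xD closed closed_far
    by (intro three_discontinuous_finite[OF three_discontinuous_M compact_M])
      (auto simp: disjnt_iff far_def)
  moreover have "h \<in> T1 \<union> T2" if h: "h \<in> stabilizer G \<alpha> p" "orb h \<in> D" "\<alpha> h x \<in> C" for h
  proof -
    have hG: "h \<in> carrier G" "\<alpha> h p = p" using h(1) by (auto simp: stabilizer_def)
    let ?y = "orb (inv h)"
    have y: "?y \<in> topspace M" "\<alpha> h ?y = b" using hG(1) orb_in act_orb orb_one by auto
    have "?y \<noteq> b" using y(2) h(2) CD(5) by auto
    moreover have "?y \<notin> M interior_of C \<or> ?y \<notin> M interior_of D"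
      using CD(3) interior_of_subset[of M C] interior_of_subset[of M D] by (auto simp: disjnt_iff)
    ultimately have "?y \<in> far C \<or> ?y \<in> far D" using y(1) by (auto simp: far_def)
    then show ?thesis using hG h(2,3) y(2) unfolding T1_def T2_def by auto
  qed
  ultimately have "{h \<in> stabilizer G \<alpha> p. orb h \<in> D \<and> \<alpha> h x \<in> C} \<subseteq> T1 \<union> T2" "finite (T1 \<union> T2)"
    by auto
  then show ?thesis by (rule finite_subset)
qed

lemma finite_fixing_off_neighbourhoods:
  assumes p: "p \<in> topspace M" "p \<noteq> b" and x: "x \<in> topspace M" "x \<noteq> b" "x \<noteq> p"
    and E: "closedin M E" "E \<subseteq> W" "p \<notin> E" and UW: "openin M U" "p \<in> U" "openin M W"
  shows "finite {h \<in> stabilizer G \<alpha> p. orb h \<in> E \<and> \<alpha> h x \<notin> U \<union> W}"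
proof (rule finite_subset)
  have "closedin M (topspace M - W - U)" using UW by (intro closedin_diff closedin_topspace)
  then show "finite {g \<in> carrier G. (\<exists>a\<in>{b}. \<alpha> g a \<in> E) \<and> (\<exists>a\<in>{p}. \<alpha> g a \<in> {p}) \<and>
      (\<exists>a\<in>{x}. \<alpha> g a \<in> topspace M - W - U)}"
    using assms closedin_point base_in
    by (intro three_discontinuous_finite[OF three_discontinuous_M compact_M])
      (auto simp: disjnt_iff)
qed (use M.element_image[OF _ x(1)] in \<open>auto simp: stabilizer_def\<close>)

lemma infinite_fixing_accumulates:
  assumes I: "I \<subseteq> stabilizer G \<alpha> p" "infinite I"
    and p: "p \<in> topspace M" "p \<noteq> b" and x: "x \<in> topspace M" "x \<noteq> b" "x \<noteq> p"
    and conv: "\<And>U. openin M U \<Longrightarrow> x \<in> U \<Longrightarrow> finite {h \<in> I. orb h \<notin> U}"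
    and N: "openin M N" "x \<in> N"
  shows "infinite {h \<in> I. \<alpha> h x \<in> N}"
proof
  assume "finite {h \<in> I. \<alpha> h x \<in> N}"
  obtain C D where CD: "closedin M C" "closedin M D" "p \<in> M interior_of C" "x \<in> M interior_of D"
      "disjnt C D" "b \<notin> C" "b \<notin> D"
    using closed_nhds_avoiding_orb[of p x \<one>] p x orb_one by auto
  let ?N = "M interior_of D \<inter> N"
  have "openin M ?N" using N(1) by (simp add: openin_Int)
  moreover have "{x} \<subseteq> ?N" using N(2) CD(4) by simp
  ultimately obtain E where E: "closedin M E" "{x} \<subseteq> M interior_of E" "E \<subseteq> ?N"
    by (rule normal_space_closed_nhd_within[OF normal_M closedin_point[OF x(1)]])
  have sub: "M interior_of C \<subseteq> C" "M interior_of D \<subseteq> D" "M interior_of E \<subseteq> E"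
    by (rule interior_of_subset)+
  have pE: "p \<notin> E" using E(3) CD(3,5) sub unfolding disjnt_iff by blast
  have "I \<subseteq> {h \<in> I. \<alpha> h x \<in> N} \<union> {h \<in> I. orb h \<notin> M interior_of E} \<union>
      {h \<in> stabilizer G \<alpha> p. orb h \<in> E \<and> \<alpha> h x \<notin> M interior_of C \<union> ?N} \<union>
      {h \<in> stabilizer G \<alpha> p. orb h \<in> D \<and> \<alpha> h x \<in> C}"
    using I(1) E(3) sub by blast
  moreover have "finite {h \<in> I. orb h \<notin> M interior_of E}" using conv E(2) by auto
  moreover have "finite {h \<in> stabilizer G \<alpha> p. orb h \<in> E \<and> \<alpha> h x \<notin> M interior_of C \<union> ?N}"
    using p x E(1,3) pE CD(3) \<open>openin M ?N\<close> by (intro finite_fixing_off_neighbourhoods) auto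
  moreover have "finite {h \<in> stabilizer G \<alpha> p. orb h \<in> D \<and> \<alpha> h x \<in> C}"
    using CD by (intro finite_fixing_pulled_apart) auto
  ultimately show False
    using \<open>finite {h \<in> I. \<alpha> h x \<in> N}\<close> I(2) by (meson finite_UnI finite_subset)
qed

lemma horocyclic_if_infinitely_often_between:
  assumes x: "floyd.approaches x a" "\<Phi> a = p" and y: "floyd.approaches y a'" "\<Phi> a' = p"
    and g: "infinite {n. between (x n) g (y n)}"
  shows "horocyclic p g"
  unfolding horocyclic_def
proof (intro allI impI)
  have lim: "limitin M (\<lambda>n. orb (x n)) p sequentially" "limitin M (\<lambda>n. orb (y n)) p sequentially"
    using approaches_limitin_orb[OF x(1)] approaches_limitin_orb[OF y(1)] x(2) y(2) by simp_all
  fix U assume "openin M U \<and> p \<in> U"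
  with lim have "\<forall>\<^sub>F n in sequentially. orb (x n) \<in> U \<and> orb (y n) \<in> U"
    by (simp add: limitin_def eventually_conj_iff)
  from not_finite_existsD[OF infinite_eventually[OF g this]]
  obtain n where "n \<in> {n. between (x n) g (y n)} \<and> orb (x n) \<in> U \<and> orb (y n) \<in> U" ..
  then show "\<exists>x y. between x g y \<and> orb x \<in> U \<and> orb y \<in> U" by blast
qed

lemma ex_horocyclic_sequence:
  assumes a: "a \<in> floyd_boundary G S f" and a': "a' \<in> floyd_boundary G S f"
    and "a \<noteq> a'" "\<Phi> a = p" "\<Phi> a' = p"
  obtains z where "floyd.approaches z a" "\<And>m. horocyclic p (z m)"
proof -
  obtain x where x: "floyd.approaches x a"
    using floyd.ex_approaches a by (auto simp: floyd_boundary_iff)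
  obtain y where y: "floyd.approaches y a'"
    using floyd.ex_approaches a' by (auto simp: floyd_boundary_iff)
  obtain s where "infinite {n. between (x n) s (y n)}"
    using geodesics_between_distinct_limits_share_vertex[OF x y \<open>a \<noteq> a'\<close>] ..
  then obtain z where "floyd.approaches z a" "\<And>m. infinite {n. between (x n) (z m) (y n)}"
    using limit_ray_of_geodesics[OF x] a by (auto simp: floyd_boundary_iff)
  then show thesis
    using that horocyclic_if_infinitely_often_between[OF x \<open>\<Phi> a = p\<close> y \<open>\<Phi> a' = p\<close>] by blast
qed

end


section \<open>Fibres of the Floyd map\<close>

locale floyd_map = floyd_orbit_map G S f M \<alpha> b \<Phi>
  for G (structure) and S f and M :: "'m topology" and \<alpha> b \<Phi> +
  fixes X :: "'x topology" and \<phi> :: "'a \<Rightarrow> 'x \<Rightarrow> 'x" and j :: "'x \<Rightarrow> 'm"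
    and F :: "(nat \<Rightarrow> 'a) set \<Rightarrow> 'x"
  assumes compact_X: "compact_space X" and Hausdorff_X: "Hausdorff_space X"
    and homeos_X: "acts_by_homeos G X \<phi>" and two_cocompact_X: "two_cocompact G X \<phi>"
    and embedding: "embedding_map X M j" and base_not_in_image: "b \<notin> j ` topspace X"
    and equivariant: "g \<in> carrier G \<Longrightarrow> x \<in> topspace X \<Longrightarrow> j (\<phi> g x) = \<alpha> g (j x)"
    and boundary_map: "a \<in> floyd_boundary G S f \<Longrightarrow> F a \<in> topspace X \<and> \<Phi> a = j (F a)"
begin

sublocale X: group_action G "topspace X" \<phi>
  using homeos_X by (simp add: acts_by_homeos_def)

lemma homeomorphic_map_embedding: "homeomorphic_map X (subtopology M (j ` topspace X)) j"
  using embedding by (simp add: embedding_map_def)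

lemma continuous_map_embedding: "continuous_map X M j"
  using homeomorphic_imp_continuous_map[OF homeomorphic_map_embedding]
  by (simp add: continuous_map_in_subtopology)

lemma inj_on_embedding: "inj_on j (topspace X)"
  by (rule homeomorphic_imp_injective_map[OF homeomorphic_map_embedding])

lemma embedding_in: "x \<in> topspace X \<Longrightarrow> j x \<in> topspace M"
  using continuous_map_image_subset_topspace[OF continuous_map_embedding] by blast

lemma embedding_eq_iff: "x \<in> topspace X \<Longrightarrow> y \<in> topspace X \<Longrightarrow> j x = j y \<longleftrightarrow> x = y"
  by (rule inj_on_eq_iff[OF inj_on_embedding])

lemma closedin_embedding_image: "closedin X A \<Longrightarrow> closedin M (j ` A)"
  using closedin_compact_space[OF compact_X] image_compactin[OF _ continuous_map_embedding]
    compactin_imp_closedin[OF Hausdorff_M] by blast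

lemma openin_embedding_extend:
  assumes "openin X N"
  obtains N' where "openin M N'" "\<And>x. x \<in> topspace X \<Longrightarrow> j x \<in> N' \<longleftrightarrow> x \<in> N"
proof -
  have "openin (subtopology M (j ` topspace X)) (j ` N)"
    using homeomorphic_imp_open_map[OF homeomorphic_map_embedding] assms by (simp add: open_map_def)
  then obtain N' where N': "openin M N'" "j ` N = N' \<inter> j ` topspace X"
    by (auto simp: openin_subtopology)
  have "j x \<in> N' \<longleftrightarrow> x \<in> N" if x: "x \<in> topspace X" for x
  proof -
    have "j x \<in> N' \<longleftrightarrow> j x \<in> j ` N" using N'(2) x by blast
    then show ?thesis
      using inj_on_image_mem_iff[OF inj_on_embedding x openin_subset[OF assms]] by simp
  qed
  with N'(1) show thesis by (rule that)
qed

lemma embedding_not_orb: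
  assumes x: "x \<in> topspace X" and g: "g \<in> carrier G"
  shows "j x \<noteq> orb g"
proof
  assume "j x = orb g"
  then have "j (\<phi> (inv g) x) = b"
    using equivariant[of "inv g" x] M.act_inv_act[OF g base_in] x g by simp
  moreover have "\<phi> (inv g) x \<in> topspace X" using X.element_image[of "inv g" x] x g by auto
  ultimately show False using base_not_in_image by blast
qed

lemma stabilizer_embedding:
  assumes "p \<in> topspace X"
  shows "stabilizer G \<alpha> (j p) = stabilizer G \<phi> p"
  using assms X.element_image
  by (auto simp: stabilizer_def embedding_eq_iff simp flip: equivariant)

lemma properly_discontinuous_at_if_embedding:
  assumes "properly_discontinuous_at H M \<alpha> (j q)" and H: "H \<subseteq> carrier G" and q: "q \<in> topspace X"
  shows "properly_discontinuous_at H X \<phi> q"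
proof -
  obtain U where U: "openin M U" "j q \<in> U" "finite {h \<in> H. \<alpha> h ` U \<inter> U \<noteq> {}}"
    using assms(1) by (auto simp: properly_discontinuous_at_def)
  let ?N = "{x \<in> topspace X. j x \<in> U}"
  have "{h \<in> H. \<phi> h ` ?N \<inter> ?N \<noteq> {}} \<subseteq> {h \<in> H. \<alpha> h ` U \<inter> U \<noteq> {}}"
  proof
    fix h assume "h \<in> {h \<in> H. \<phi> h ` ?N \<inter> ?N \<noteq> {}}"
    then obtain x where x: "h \<in> H" "x \<in> topspace X" "j x \<in> U" "j (\<phi> h x) \<in> U" by auto
    then have "\<alpha> h (j x) \<in> U" using H equivariant[of h x] by auto
    then show "h \<in> {h \<in> H. \<alpha> h ` U \<inter> U \<noteq> {}}" using x by blast
  qed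
  then have "finite {h \<in> H. \<phi> h ` ?N \<inter> ?N \<noteq> {}}" using U(3) by (rule finite_subset)
  moreover have "openin X ?N"
    by (rule openin_continuous_map_preimage[OF continuous_map_embedding U(1)])
  ultimately show ?thesis using q U(2) unfolding properly_discontinuous_at_def by blast
qed

lemma horocyclic_translate:
  assumes "q \<in> topspace X" "horocyclic (j q) g" "k \<in> carrier G"
  shows "horocyclic (j (\<phi> k q)) (k \<otimes> g)"
  using horocyclic_left_mult[OF assms(3) embedding_in[OF assms(1)] assms(2)] assms(1,3)
  by (simp add: equivariant)

lemma finite_horocyclic_for_both_images:
  assumes AB: "closedin X A" "closedin X B" "disjnt A B"
  shows "finite {g \<in> carrier G. (\<exists>q\<in>A. horocyclic (j q) g) \<and> (\<exists>q\<in>B. horocyclic (j q) g)}"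
proof -
  have "j ` A \<inter> j ` B = j ` (A \<inter> B)"
    using inj_on_image_Int[OF inj_on_embedding] AB(1,2) closedin_subset by metis
  then have "disjnt (j ` A) (j ` B)" using AB(3) by (simp add: disjnt_def)
  from finite_horocyclic_for_both[OF AB(1,2)[THEN closedin_embedding_image] this]
  show ?thesis by (simp add: image_iff)
qed

text \<open>If some \<open>g\<close> moves \<open>q\<close> and \<open>Q\<close> into disjoint sets of a fixed finite collection of closed sets,
  then \<open>g\<close> is horocyclic for points of both sets, which leaves finitely many \<open>g\<close>.\<close>

lemma horocyclic_point_isolated:
  assumes Q: "Q \<in> topspace X" "horocyclic (j Q) \<one>"
  obtains C where "closedin X C" "Q \<notin> C" "{q \<in> topspace X. horocyclic (j q) \<one>} - {Q} \<subseteq> C"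
proof -
  obtain P where P: "finite P" "\<And>A B. (A, B) \<in> P \<Longrightarrow> closedin X A \<and> closedin X B \<and> disjnt A B"
    and separating: "\<And>x y. \<lbrakk>x \<in> topspace X; y \<in> topspace X; x \<noteq> y\<rbrakk> \<Longrightarrow>
      \<exists>g\<in>carrier G. \<exists>A B. (A, B) \<in> P \<and> \<phi> g x \<in> A \<and> \<phi> g y \<in> B"
    using two_cocompact_separation[OF homeos_X two_cocompact_X compact_X Hausdorff_X] by metis
  define T where "T A B = {g \<in> carrier G. \<phi> g Q \<in> B \<and>
    (\<exists>q\<in>A. horocyclic (j q) g) \<and> (\<exists>q\<in>B. horocyclic (j q) g)}" for A B
  define C where "C = (\<Union>(A, B)\<in>P. \<Union>g\<in>T A B. {x \<in> topspace X. \<phi> g x \<in> A})"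
  have "closedin X (\<Union>g\<in>T A B. {x \<in> topspace X. \<phi> g x \<in> A})" if "(A, B) \<in> P" for A B
  proof (rule closedin_Union)
    have "finite {g \<in> carrier G. (\<exists>q\<in>A. horocyclic (j q) g) \<and> (\<exists>q\<in>B. horocyclic (j q) g)}"
      using P(2)[OF that] by (intro finite_horocyclic_for_both_images) auto
    then have "finite (T A B)" unfolding T_def by (rule rev_finite_subset) blast
    then show "finite ((\<lambda>g. {x \<in> topspace X. \<phi> g x \<in> A}) ` T A B)" by simp
    show "closedin X Z" if "Z \<in> (\<lambda>g. {x \<in> topspace X. \<phi> g x \<in> A}) ` T A B" for Z
      using that P(2)[OF \<open>(A, B) \<in> P\<close>] acts_by_homeos_continuous_map[OF homeos_X]
        closedin_continuous_map_preimage by (fastforce simp: T_def)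
  qed
  then have "closedin X C" unfolding C_def using P(1) by (intro closedin_Union finite_imageI) auto
  moreover have "Q \<notin> C"
    using P(2) by (auto simp: C_def T_def disjnt_iff)
  moreover have "q \<in> C" if q: "q \<in> topspace X" "horocyclic (j q) \<one>" "q \<noteq> Q" for q
  proof -
    obtain g A B where g: "g \<in> carrier G" "(A, B) \<in> P" "\<phi> g q \<in> A" "\<phi> g Q \<in> B"
      using separating[OF q(1) Q(1) q(3)] by blast
    have "horocyclic (j (\<phi> g q)) g" "horocyclic (j (\<phi> g Q)) g"
      using horocyclic_translate[of _ \<one> g] q Q g(1) by auto
    then have "g \<in> T A B" using g by (auto simp: T_def)
    then show ?thesis using g q(1) by (force simp: C_def)
  qed
  ultimately show thesis by (intro that[of C]) auto
qed

lemma finite_horocyclic_points: "finite {q \<in> topspace X. horocyclic (j q) \<one>}" (is "finite ?H")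
proof (rule ccontr)
  assume "infinite ?H"
  then obtain Q where Q: "Q \<in> X derived_set_of ?H"
    using compact_space_imp_Bolzano_Weierstrass[OF compact_X, of ?H] by blast
  then have QX: "Q \<in> topspace X" by (simp add: in_derived_set_of)
  have "?H = {q \<in> topspace X. j q \<in> {q \<in> topspace M. horocyclic q \<one>}}" using embedding_in by auto
  then have "closedin X ?H"
    using closedin_continuous_map_preimage[OF continuous_map_embedding closedin_horocyclic] by simp
  then have "horocyclic (j Q) \<one>" using Q by (auto simp: closedin_contains_derived_set)
  with QX obtain C where C: "closedin X C" "Q \<notin> C" "?H - {Q} \<subseteq> C"
    by (rule horocyclic_point_isolated)
  have "openin X (topspace X - C)" using C(1) by blast
  then obtain q where "q \<noteq> Q" "q \<in> ?H" "q \<in> topspace X - C"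
    using Q C(2) QX unfolding in_derived_set_of by blast
  then show False using C(3) by blast
qed

lemma horocyclic_near_stabilizer:
  assumes p: "p \<in> topspace X"
  shows "\<exists>R. \<forall>g\<in>carrier G. horocyclic (j p) g \<longrightarrow>
    (\<exists>h\<in>stabilizer G \<phi> p. graph_dist (cayley_edges G S) h g \<le> R)"
proof -
  let ?H = "{q \<in> topspace X. horocyclic (j q) \<one>}"
  let ?near = "\<lambda>g R. \<exists>h\<in>stabilizer G \<phi> p. graph_dist (cayley_edges G S) h g \<le> R"
  have "\<exists>R. \<forall>g\<in>carrier G. \<phi> (inv g) p = q \<longrightarrow> ?near g R" for q
  proof (cases "\<exists>k\<in>carrier G. \<phi> (inv k) p = q")
    case True
    then obtain k where k: "k \<in> carrier G" "\<phi> (inv k) p = q" by blast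
    have "?near g (depth k)" if g: "g \<in> carrier G" "\<phi> (inv g) p = q" for g
    proof
      show "g \<otimes> inv k \<in> stabilizer G \<phi> p" using X.mult_inv_in_stabilizer g k p by simp
      have "graph_dist (cayley_edges G S) (g \<otimes> inv k \<otimes> \<one>) (g \<otimes> inv k \<otimes> k) = depth k"
        using g k by (intro graph_dist_left_mult) auto
      then show "graph_dist (cayley_edges G S) (g \<otimes> inv k) g \<le> depth k"
        using g k by (simp add: m_assoc)
    qed
    then show ?thesis by blast
  qed blast
  then obtain r where r: "\<And>q g. g \<in> carrier G \<Longrightarrow> \<phi> (inv g) p = q \<Longrightarrow> ?near g (r q)" by metis
  have "?near g (Max (r ` ?H))" if g: "g \<in> carrier G" "horocyclic (j p) g" for g
  proof -
    have "horocyclic (j (\<phi> (inv g) p)) \<one>"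
      using horocyclic_translate[OF p g(2), of "inv g"] g(1) by simp
    moreover have "\<phi> (inv g) p \<in> topspace X" using X.element_image[of "inv g" p] g(1) p by auto
    ultimately have "r (\<phi> (inv g) p) \<le> Max (r ` ?H)"
      using finite_horocyclic_points by (intro Max_ge) auto
    then show ?thesis using r[OF g(1) refl] by (meson order_trans)
  qed
  then show ?thesis by blast
qed

lemma in_floyd_frontier_iff:
  assumes "H \<subseteq> carrier G"
  shows "a \<in> floyd_completion G S f frontier_of (floyd_embed G S f ` H) \<longleftrightarrow>
    a \<in> floyd_boundary G S f \<and> (\<exists>s. range s \<subseteq> H \<and> floyd.approaches s a)"
  using floyd.in_frontier_of_membed_iff[OF floyd_mtopology_eq_discrete assms]
  by (auto simp: floyd_completion_eq floyd_embed_eq floyd_boundary_iff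
      dest: floyd.approaches_in_completion)

lemma boundary_map_eq_if_in_frontier:
  assumes par: "parabolic_point G X \<phi> p"
    and a: "a \<in> floyd_completion G S f frontier_of (floyd_embed G S f ` stabilizer G \<phi> p)"
  shows "F a = p"
proof (rule ccontr)
  assume "F a \<noteq> p"
  let ?H = "stabilizer G \<phi> p"
  have p: "p \<in> topspace X" using par by (simp add: parabolic_point_iff)
  obtain s where s: "range s \<subseteq> ?H" "floyd.approaches s a" and aB: "a \<in> floyd_boundary G S f"
    using a in_floyd_frontier_iff[OF X.stabilizer_subset] by blast
  have Fa: "F a \<in> topspace X" "\<Phi> a = j (F a)" using boundary_map[OF aB] by auto
  obtain N where N: "openin X N" "F a \<in> N" "finite {h \<in> ?H. \<phi> h ` N \<inter> N \<noteq> {}}"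
    using par Fa(1) \<open>F a \<noteq> p\<close> by (auto simp: parabolic_point_iff properly_discontinuous_at_def)
  obtain N' where N': "openin M N'" "\<And>x. x \<in> topspace X \<Longrightarrow> j x \<in> N' \<longleftrightarrow> x \<in> N"
    using openin_embedding_extend[OF N(1)] by blast
  have "infinite {h \<in> range s. \<alpha> h (j (F a)) \<in> N'}"
  proof (rule infinite_fixing_accumulates)
    show "range s \<subseteq> stabilizer G \<alpha> (j p)" using s(1) by (simp add: stabilizer_embedding[OF p])
    show "infinite (range s)"
      using floyd.infinite_range_if_approaches[OF s(2)] aB by (simp add: floyd_boundary_iff)
    show "j p \<noteq> b" "j (F a) \<noteq> b" using base_not_in_image p Fa(1) by auto
    show "j (F a) \<noteq> j p" using \<open>F a \<noteq> p\<close> p Fa(1) by (simp add: embedding_eq_iff)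
    show "openin M N'" "j (F a) \<in> N'" using N' N(2) Fa(1) by auto
    show "finite {h \<in> range s. orb h \<notin> U}" if "openin M U" "j (F a) \<in> U" for U
      using finite_range_outside_if_approaches[OF s(2)] that Fa(2) by simp
  qed (use p Fa(1) in \<open>simp_all add: embedding_in\<close>)
  moreover have "{h \<in> range s. \<alpha> h (j (F a)) \<in> N'} \<subseteq> {h \<in> ?H. \<phi> h ` N \<inter> N \<noteq> {}}"
  proof
    fix h assume h: "h \<in> {h \<in> range s. \<alpha> h (j (F a)) \<in> N'}"
    then have "h \<in> ?H" "h \<in> carrier G" using s(1) X.stabilizer_subset by auto
    moreover from this have "\<phi> h (F a) \<in> N"
      using h N'(2) equivariant X.element_image Fa(1) by force
    ultimately show "h \<in> {h \<in> ?H. \<phi> h ` N \<inter> N \<noteq> {}}" using N(2) by blast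
  qed
  ultimately show False using N(3) finite_subset by blast
qed

lemma in_frontier_if_boundary_map_eq:
  assumes a: "a \<in> floyd_boundary G S f" and a': "a' \<in> floyd_boundary G S f"
    and "a \<noteq> a'" "F a = p" "F a' = p"
  shows "a \<in> floyd_completion G S f frontier_of (floyd_embed G S f ` stabilizer G \<phi> p)"
proof -
  have p: "p \<in> topspace X" "\<Phi> a = j p" "\<Phi> a' = j p" using boundary_map a a' assms(4,5) by auto
  obtain z where z: "floyd.approaches z a" "\<And>m. horocyclic (j p) (z m)"
    using ex_horocyclic_sequence[OF a a' \<open>a \<noteq> a'\<close> p(2,3)] by blast
  obtain R where "\<forall>g\<in>carrier G. horocyclic (j p) g \<longrightarrow>
      (\<exists>h\<in>stabilizer G \<phi> p. graph_dist (cayley_edges G S) h g \<le> R)"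
    using horocyclic_near_stabilizer[OF p(1)] ..
  then have "\<forall>m. \<exists>h. h \<in> stabilizer G \<phi> p \<and> graph_dist (cayley_edges G S) h (z m) \<le> R"
    using z(2) floyd.approaches_in[OF z(1)] by blast
  then obtain h where h: "\<And>m. h m \<in> stabilizer G \<phi> p"
    "\<And>m. graph_dist (cayley_edges G S) (z m) (h m) \<le> R"
    by (metis graph_dist_commute)
  have "floyd.approaches h a"
    using a h X.stabilizer_subset
    by (intro approaches_if_bounded_graph_dist[OF z(1)]) (auto simp: floyd_boundary_iff)
  then show ?thesis using a h(1) by (auto simp: in_floyd_frontier_iff[OF X.stabilizer_subset])
qed

theorem fibre_eq_frontier:
  assumes par: "parabolic_point G X \<phi> p"
  shows "{a \<in> floyd_boundary G S f. F a = p} =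
    floyd_completion G S f frontier_of (floyd_embed G S f ` stabilizer G \<phi> p)" (is "_ = ?frontier")
proof -
  have frontier: "c \<in> floyd_boundary G S f \<and> F c = p" if "c \<in> ?frontier" for c
    using that boundary_map_eq_if_in_frontier[OF par] in_floyd_frontier_iff[OF X.stabilizer_subset]
    by blast
  have "infinite (stabilizer G \<phi> p)" using par by (simp add: parabolic_point_iff)
  then have "?frontier \<noteq> {}"
    using floyd.frontier_of_membed_nonempty[OF floyd_mtopology_eq_discrete
        floyd.mtotally_bounded_subset[OF floyd_mtotally_bounded X.stabilizer_subset]]
    by (simp add: floyd_completion_eq floyd_embed_eq)
  then obtain c where c: "c \<in> ?frontier" by blast
  have "a \<in> ?frontier" if "a \<in> floyd_boundary G S f" "F a = p" for a
    using c frontier[OF c] in_frontier_if_boundary_map_eq[OF that(1)] that by (cases "a = c") auto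
  then show ?thesis using frontier by blast
qed

theorem parabolic_if_boundary_map_not_injective:
  assumes a: "a \<in> floyd_boundary G S f" and a': "a' \<in> floyd_boundary G S f"
    and "a \<noteq> a'" "F a = p" "F a' = p"
  shows "parabolic_point G X \<phi> p"
proof -
  let ?H = "stabilizer G \<phi> p"
  have p: "p \<in> topspace X" "\<Phi> a = j p" "\<Phi> a' = j p" using boundary_map a a' assms(4,5) by auto
  have "infinite ?H"
    using in_frontier_if_boundary_map_eq[OF assms] X.stabilizer_subset
      floyd.infinite_if_in_frontier_of_membed[OF floyd_mtopology_eq_discrete]
    by (simp add: floyd_completion_eq floyd_embed_eq)
  moreover have "properly_discontinuous_at ?H X \<phi> q" if q: "q \<in> topspace X - {p}" for q
  proof -
    obtain z where z: "floyd.approaches z a" "\<And>m. horocyclic (j p) (z m)"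
      using ex_horocyclic_sequence[OF a a' \<open>a \<noteq> a'\<close> p(2,3)] by blast
    have "properly_discontinuous_at (stabilizer G \<alpha> (j p)) M \<alpha> (j q)"
      using p(1) q z(2) floyd.approaches_in[OF z(1), of 0]
      by (intro stabilizer_properly_discontinuous_at[of _ "z 0"])
        (auto simp: embedding_in embedding_eq_iff embedding_not_orb)
    then show ?thesis
      using properly_discontinuous_at_if_embedding[OF _ X.stabilizer_subset] q
      by (simp add: stabilizer_embedding[OF p(1)])
  qed
  ultimately show ?thesis using p(1) by (simp add: parabolic_point_iff)
qed

end


section \<open>Boundary maps of exponential Floyd functions\<close>

lemma openin_compact_sum_vertex:
  assumes M: "compact_sum_topology X V M" and X: "compact_space X" and v: "v \<in> V"
  shows "openin M {Inr v}"
proof -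
  have "homeomorphic_map (discrete_topology V) (subtopology M (Inr ` V)) Inr"
    using M by (simp add: compact_sum_topology_def embedding_map_def)
  then have "open_map (discrete_topology V) (subtopology M (Inr ` V)) Inr"
    by (rule homeomorphic_imp_open_map)
  then have "openin (subtopology M (Inr ` V)) (Inr ` {v})"
    unfolding open_map_def openin_discrete_topology using v by blast
  then obtain T where T: "openin M T" "{Inr v} = T \<inter> Inr ` V" by (auto simp: openin_subtopology)
  have "continuous_map X M Inl"
    using M unfolding compact_sum_topology_def embedding_map_def
    by (metis continuous_map_in_subtopology homeomorphic_imp_continuous_map)
  then have "closedin M (Inl ` topspace X)"
    using X M image_compactin compactin_imp_closedin
    unfolding compact_space_def compact_sum_topology_def by metis
  moreover have "T \<inter> Inr ` V = T \<inter> (topspace M - Inl ` topspace X)"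
    using M by (auto simp: compact_sum_topology_def)
  ultimately show ?thesis using T by (simp add: openin_Int openin_diff)
qed

lemma quasi_isometric_map_bounded_fibres:
  assumes "quasi_isometric_map A d d' h" "\<And>x. d' x x = 0"
  obtains r where "\<And>x y. x \<in> A \<Longrightarrow> y \<in> A \<Longrightarrow> h x = h y \<Longrightarrow> d x y \<le> r"
proof -
  obtain c :: real where c: "c \<ge> 1" "\<And>x y. x \<in> A \<Longrightarrow> y \<in> A \<Longrightarrow> d x y / c - c \<le> d' (h x) (h y)"
    using assms(1) unfolding quasi_isometric_map_def by blast
  have "d x y \<le> nat \<lceil>c * c\<rceil>" if "x \<in> A" "y \<in> A" "h x = h y" for x y
  proof -
    have "d x y / c - c \<le> 0" using c(2)[OF that(1,2)] that(3) assms(2) by simp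
    then have "real (d x y) \<le> c * c" using c(1) by (simp add: field_simps)
    then show ?thesis by linarith
  qed
  then show thesis by (rule that)
qed

lemma (in cayley) finite_quasi_isometric_fibre:
  assumes "quasi_isometric_map (carrier G) (graph_dist (cayley_edges G S)) (graph_dist E) \<psi>"
    and g: "g \<in> carrier G"
  shows "finite {h \<in> carrier G. \<psi> h = \<psi> g}"
proof -
  obtain r where "\<And>x y. x \<in> carrier G \<Longrightarrow> y \<in> carrier G \<Longrightarrow> \<psi> x = \<psi> y \<Longrightarrow>
      graph_dist (cayley_edges G S) x y \<le> r"
    using quasi_isometric_map_bounded_fibres[OF assms(1) graph_dist_self] by blast
  then have "{h \<in> carrier G. \<psi> h = \<psi> g} \<subseteq> {h \<in> carrier G. graph_dist (cayley_edges G S) g h \<le> r}"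
    using g by auto
  then show ?thesis
    using finite_graph_ball[OF locally_finite_graph_cayley g] by (rule finite_subset)
qed

context cayley
begin

context
  fixes X :: "'x topology" and \<phi> :: "'a \<Rightarrow> 'x \<Rightarrow> 'x" and lam :: real
    and V :: "'v set" and E :: "'v set set" and \<rho> :: "'a \<Rightarrow> 'v \<Rightarrow> 'v" and M :: "('x + 'v) topology"
    and \<psi> :: "'a \<Rightarrow> 'v" and \<Psi> :: "(nat \<Rightarrow> 'a) set \<Rightarrow> 'x + 'v" and F\<^sub>0 :: "(nat \<Rightarrow> 'a) set \<Rightarrow> 'x"
    and f :: "nat \<Rightarrow> real" and chi :: "(nat \<Rightarrow> 'a) set \<Rightarrow> (nat \<Rightarrow> 'a) set"
  assumes compact: "compact_space X"
    and exponential: "exponential_floyd_map G S X \<phi> lam V E \<rho> M \<psi> \<Psi> F\<^sub>0"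
    and floyd_function: "floyd_function f"
    and chi: "extends_identity G S f (\<lambda>n. lam ^ n) chi"
begin

lemma compact_sum: "compact_sum_topology X V M"
  using exponential by (simp add: exponential_floyd_map_def)

lemma orbit_map_in: "g \<in> carrier G \<Longrightarrow> \<psi> g \<in> V"
  using exponential by (auto simp: exponential_floyd_map_def)

lemma extension_embed_vertex: "g \<in> carrier G \<Longrightarrow> \<Psi> (floyd_embed G S (\<lambda>n. lam ^ n) g) = Inr (\<psi> g)"
  using exponential by (simp add: exponential_floyd_map_def)

lemma sum_action_base:
  assumes "g \<in> carrier G"
  shows "sum_action M \<phi> \<rho> g (Inr (\<psi> \<one>)) = Inr (\<psi> g)"
proof -
  have "\<psi> g = \<rho> g (\<psi> \<one>)"
    using exponential assms unfolding exponential_floyd_map_def by (metis one_closed r_one)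
  moreover have "Inr (\<psi> \<one>) \<in> topspace M"
    using compact_sum orbit_map_in by (simp add: compact_sum_topology_def)
  ultimately show ?thesis by (simp add: sum_action_def)
qed

lemma floyd_orbit_map_sum_action:
  "floyd_orbit_map G S f M (sum_action M \<phi> \<rho>) (Inr (\<psi> \<one>)) (\<Psi> \<circ> chi)"
proof unfold_locales
  show "floyd_function f" by (rule floyd_function)
  show "compact_space M" "Hausdorff_space M"
    using compact_sum by (auto simp: compact_sum_topology_def)
  show "acts_by_homeos G M (sum_action M \<phi> \<rho>)" "three_discontinuous G M (sum_action M \<phi> \<rho>)"
    using exponential by (auto simp: exponential_floyd_map_def)
  show "openin M {Inr (\<psi> \<one>)}"
    by (intro openin_compact_sum_vertex[OF compact_sum compact] orbit_map_in one_closed)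
  have "stabilizer G (sum_action M \<phi> \<rho>) (Inr (\<psi> \<one>)) = {g \<in> carrier G. \<psi> g = \<psi> \<one>}"
    by (auto simp: stabilizer_def sum_action_base)
  moreover have "quasi_isometric_map (carrier G) (graph_dist (cayley_edges G S)) (graph_dist E) \<psi>"
    using exponential by (simp add: exponential_floyd_map_def)
  from finite_quasi_isometric_fibre[OF this one_closed] have "finite {g \<in> carrier G. \<psi> g = \<psi> \<one>}" .
  ultimately show "finite (stabilizer G (sum_action M \<phi> \<rho>) (Inr (\<psi> \<one>)))" by simp
  show "continuous_map (floyd_completion G S f) M (\<Psi> \<circ> chi)"
    using chi exponential continuous_map_compose
    unfolding extends_identity_def exponential_floyd_map_def by blast
  show "(\<Psi> \<circ> chi) (floyd_embed G S f g) = sum_action M \<phi> \<rho> g (Inr (\<psi> \<one>))" if "g \<in> carrier G" for g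
    using chi that by (simp add: extends_identity_def extension_embed_vertex sum_action_base)
qed

lemma extends_identity_boundary:
  assumes a: "a \<in> floyd_boundary G S f"
  shows "chi a \<in> floyd_boundary G S (\<lambda>n. lam ^ n)"
proof -
  interpret floyd_orbit_map G S f M "sum_action M \<phi> \<rho>" "Inr (\<psi> \<one>)" "\<Psi> \<circ> chi"
    by (rule floyd_orbit_map_sum_action)
  have "chi a \<noteq> floyd_embed G S (\<lambda>n. lam ^ n) g" if g: "g \<in> carrier G" for g
    using extension_boundary_not_orb[OF a g] extension_embed_vertex[OF g] sum_action_base[OF g]
    by auto
  moreover have "chi a \<in> topspace (floyd_completion G S (\<lambda>n. lam ^ n))"
    using chi a continuous_map_image_subset_topspace
    unfolding extends_identity_def floyd_boundary_def by blast
  ultimately show ?thesis by (auto simp: floyd_boundary_def)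
qed

lemma floyd_map_sum_action:
  assumes "Hausdorff_space X" "acts_by_homeos G X \<phi>" "two_cocompact G X \<phi>"
  shows "floyd_map G S f M (sum_action M \<phi> \<rho>) (Inr (\<psi> \<one>)) (\<Psi> \<circ> chi) X \<phi> Inl (F\<^sub>0 \<circ> chi)"
proof (intro floyd_map.intro floyd_orbit_map_sum_action floyd_map_axioms.intro assms compact)
  show "embedding_map X M Inl" using compact_sum by (simp add: compact_sum_topology_def)
  show "Inr (\<psi> \<one>) \<notin> Inl ` topspace X" by auto
  show "Inl (\<phi> g x) = sum_action M \<phi> \<rho> g (Inl x)" if "g \<in> carrier G" "x \<in> topspace X" for g x
    using compact_sum that(2) by (simp add: sum_action_def compact_sum_topology_def)
  show "(F\<^sub>0 \<circ> chi) a \<in> topspace X \<and> (\<Psi> \<circ> chi) a = Inl ((F\<^sub>0 \<circ> chi) a)"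
    if "a \<in> floyd_boundary G S f" for a
    using exponential extends_identity_boundary[OF that] by (simp add: exponential_floyd_map_def)
qed

end

end

theorem theoremA:
  fixes G :: "('g, 'm) monoid_scheme" and S :: "'g set"
    and X :: "'a topology" and \<phi> :: "'g \<Rightarrow> 'a \<Rightarrow> 'a"
    and lam :: real
    and V :: "'v set" and E :: "'v set set" and \<rho> :: "'g \<Rightarrow> 'v \<Rightarrow> 'v"
    and M :: "('a + 'v) topology" and \<psi> :: "'g \<Rightarrow> 'v"
    and \<Psi> :: "(nat \<Rightarrow> 'g) set \<Rightarrow> 'a + 'v" and F\<^sub>0 :: "(nat \<Rightarrow> 'g) set \<Rightarrow> 'a"
    and f :: "nat \<Rightarrow> real" and chi :: "(nat \<Rightarrow> 'g) set \<Rightarrow> (nat \<Rightarrow> 'g) set"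
    and F :: "(nat \<Rightarrow> 'g) set \<Rightarrow> 'a"
  assumes "group G"
    and "finite S" "S \<subseteq> carrier G" "generate G S = carrier G"
    and "compact_space X" "Hausdorff_space X"
    and "infinite (topspace X) \<or> card (topspace X) > 2"
    and "acts_by_homeos G X \<phi>"
    and "three_discontinuous G X \<phi>"
    and "two_cocompact G X \<phi>"
    and "0 < lam" "lam < 1"
    and "exponential_floyd_map G S X \<phi> lam V E \<rho> M \<psi> \<Psi> F\<^sub>0"
    and "floyd_function f" "\<And>n. n \<ge> 1 \<Longrightarrow> f n \<ge> lam ^ n"
    and "extends_identity G S f (\<lambda>n. lam ^ n) chi"
    and "F = F\<^sub>0 \<circ> chi"
  shows "(\<forall>p. parabolic_point G X \<phi> p \<longrightarrow>
            {a \<in> floyd_boundary G S f. F a = p} =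
            floyd_completion G S f frontier_of (floyd_embed G S f ` stabilizer G \<phi> p)) \<and>
         (\<forall>a\<in>floyd_boundary G S f. \<forall>b\<in>floyd_boundary G S f. \<forall>p\<in>topspace X.
            F a = p \<and> F b = p \<longrightarrow> a = b \<or> parabolic_point G X \<phi> p)"
proof -
  interpret cayley G S
    by (intro cayley.intro cayley_axioms.intro) fact+
  interpret floyd_map G S f M "sum_action M \<phi> \<rho>" "Inr (\<psi> \<one>\<^bsub>G\<^esub>)" "\<Psi> \<circ> chi" X \<phi> Inl F
    unfolding \<open>F = F\<^sub>0 \<circ> chi\<close> by (rule floyd_map_sum_action) fact+
  show ?thesis using fibre_eq_frontier parabolic_if_boundary_map_not_injective by blast
qed

end
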